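(* Under Assumptions 1–3, assume $r_\ell<\min\{m_\ell,n_\ell\}$ for all $\ell$, and let $\mathcal B\ge1$ be an integer. If $0<\beta_1\le1$, $\tau\ge\frac{64}{3\beta_1\underline\delta}$, and $0<\eta\le\min\Big\{\frac1{4L},\sqrt{\frac{3\underline\delta\beta_1^2}{80L^2}},\sqrt{\frac{\underline\delta}{40\tau^2L^2}},\sqrt{\frac{3\beta_1}{32\tau L^2}}\Big\}$, then GaLore using large-batch stochastic gradients (batch size $\mathcal B$ at subspace-refresh steps) and MSGD with momentum projection satisfies, for every integer $K\ge1$, $\frac1{K\tau}\sum_{t=0}^{K\tau-1}\mathbb{E}\|\nabla f(x^{(t)})\|_2^2\le\frac{16\Delta}{\underline\delta\eta K\tau}+\Big(\frac{160}{3\beta_1\underline\delta\tau\mathcal B}+\frac{352}{3\underline\delta^2\mathcal B}+\frac{32\beta_1}{3\underline\delta}\Big)\sigma^2.$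
   Context: Parameters $x=(\mathrm{vec}(X_1)^\top,\dots,\mathrm{vec}(X_{N_L})^\top)^\top\in\mathbb{R}^d$, $X_\ell\in\mathbb{R}^{m_\ell\times n_\ell}$; $f(x)=\mathbb{E}_{\xi\sim\mathcal D}F(x;\xi)$; $\nabla_\ell$ is the gradient w.r.t. $X_\ell$. Assumption 1: $\inf f>-\infty$. Assumption 2: $\nabla f$ is $L$-Lipschitz in $\|\cdot\|_2$. Assumption 3: $\mathbb{E}_\xi[\nabla_\ell F(x;\xi)]=\nabla_\ell f(x)$ and $\mathbb{E}_\xi\|\nabla_\ell F(x;\xi)-\nabla_\ell f(x)\|_F^2\le\sigma_\ell^2$ for all $x,\ell$; $\sigma^2=\sum_\ell\sigma_\ell^2$. $\Delta=f(x^{(0)})-\inf f$, $\delta_\ell=r_\ell/\min\{m_\ell,n_\ell\}$, $\underline\delta=\min_\ell\delta_\ell$. Algorithm: $M_\ell^{(-1)}=0$. For $t\ge0$: if $t\equiv0\pmod\tau$, draw $\xi^{(t,1)},\dots,\xi^{(t,\mathcal B)}$ i.i.d. $\sim\mathcal D$, set $G_\ell^{(t)}=\frac1{\mathcal B}\sum_b\nabla_\ell F(x^{(t)};\xi^{(t,b)})$, take an SVD $G_\ell^{(t)}=U\Sigma V^\top$ (singular values nonincreasing) and set $P_\ell^{(t)}=U[:,:r_\ell]$, $Q_\ell^{(t)}=V[:,:r_\ell]$; otherwise draw $\xi^{(t)}\sim\mathcal D$, set $G_\ell^{(t)}=\nabla_\ell F(x^{(t)};\xi^{(t)})$ and $P_\ell^{(t)}=P_\ell^{(t-1)}$,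 $Q_\ell^{(t)}=Q_\ell^{(t-1)}$ (all samples independent). If $m_\ell\le n_\ell$: $M_\ell^{(t)}=(1-\beta_1)(P_\ell^{(t)})^\top P_\ell^{(t-1)}M_\ell^{(t-1)}+\beta_1(P_\ell^{(t)})^\top G_\ell^{(t)}$, $X_\ell^{(t+1)}=X_\ell^{(t)}-\eta P_\ell^{(t)}M_\ell^{(t)}$. If $m_\ell>n_\ell$: $M_\ell^{(t)}=(1-\beta_1)M_\ell^{(t-1)}(Q_\ell^{(t-1)})^\top Q_\ell^{(t)}+\beta_1G_\ell^{(t)}Q_\ell^{(t)}$, $X_\ell^{(t+1)}=X_\ell^{(t)}-\eta M_\ell^{(t)}(Q_\ell^{(t)})^\top$. *)

theory Defs
  imports "HOL-Probability.Probability"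
begin

text \<open>Matrices are represented as functions nat => nat => real together with
explicit dimensions; only entries inside the stated dimensions are ever used.\<close>

type_synonym rmat = "nat \<Rightarrow> nat \<Rightarrow> real"

definition mmul :: "nat \<Rightarrow> rmat \<Rightarrow> rmat \<Rightarrow> rmat" where
  "mmul k A B = (\<lambda>i j. \<Sum>l<k. A i l * B l j)"

definition tr :: "rmat \<Rightarrow> rmat" where
  "tr A = (\<lambda>i j. A j i)"

definition frob2 :: "nat \<Rightarrow> nat \<Rightarrow> rmat \<Rightarrow> real" where
  "frob2 m n A = (\<Sum>i<m. \<Sum>j<n. (A i j)\<^sup>2)"

definition orthogonal_mat :: "nat \<Rightarrow> rmat \<Rightarrow> bool" where
  "orthogonal_mat k U \<longleftrightarrow> (\<forall>i<k. \<forall>j<k. (\<Sum>l<k. U l i * U l j) = (if i = j then 1 else 0))"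

definition is_svd :: "nat \<Rightarrow> nat \<Rightarrow> rmat \<Rightarrow> rmat \<Rightarrow> rmat \<Rightarrow> rmat \<Rightarrow> bool" where
  "is_svd m n G U S V \<longleftrightarrow>
     orthogonal_mat m U \<and> orthogonal_mat n V \<and>
     (\<forall>i<m. \<forall>j<n. i \<noteq> j \<longrightarrow> S i j = 0) \<and>
     (\<forall>i<min m n. 0 \<le> S i i) \<and>
     (\<forall>i. Suc i < min m n \<longrightarrow> S (Suc i) (Suc i) \<le> S i i) \<and>
     (\<forall>i<m. \<forall>j<n. G i j = (\<Sum>k<m. \<Sum>l<n. U i k * S k l * V j l))"

definition svd_trunc :: "nat \<Rightarrow> nat \<Rightarrow> nat \<Rightarrow> rmat \<Rightarrow> rmat \<Rightarrow> rmat \<Rightarrow> bool" where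
  "svd_trunc m n r G P Q \<longleftrightarrow>
     (\<exists>U S V. is_svd m n G U S V \<and>
        (\<forall>i<m. \<forall>j<r. P i j = U i j) \<and> (\<forall>i<n. \<forall>j<r. Q i j = V i j))"

text \<open>Layer block X_l of the parameter vector x; crd maps a coordinate of x to
(layer, row, column).\<close>
definition layer :: "('d \<Rightarrow> nat \<times> nat \<times> nat) \<Rightarrow> nat \<Rightarrow> real^'d \<Rightarrow> rmat" where
  "layer crd l x = (\<lambda>i j. x $ inv crd (l, i, j))"

type_synonym 'd gstate = "(real^'d) \<times> (nat \<Rightarrow> rmat) \<times> (nat \<Rightarrow> rmat) \<times> (nat \<Rightarrow> rmat)"

text \<open>galore ... \<omega> t = (x^(t), P^(t-1), Q^(t-1), M^(t-1)); samples are
\<omega> (t,b) (batch at refresh steps), \<omega> (t,0) otherwise.  sel t l G returns the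
chosen (P, Q) from an SVD of G.\<close>
fun galore ::
  "('d \<Rightarrow> nat \<times> nat \<times> nat) \<Rightarrow> (nat \<Rightarrow> nat) \<Rightarrow> (nat \<Rightarrow> nat) \<Rightarrow> (nat \<Rightarrow> nat) \<Rightarrow>
   (real^'d \<Rightarrow> 'b \<Rightarrow> real^'d) \<Rightarrow> (nat \<Rightarrow> nat \<Rightarrow> rmat \<Rightarrow> rmat \<times> rmat) \<Rightarrow>
   real^'d \<Rightarrow> real \<Rightarrow> real \<Rightarrow> nat \<Rightarrow> nat \<Rightarrow> (nat \<times> nat \<Rightarrow> 'b) \<Rightarrow> nat \<Rightarrow> 'd gstate" where
  "galore crd m n r gradF sel x0 \<beta> \<eta> \<tau> B \<omega> 0 =
     (x0, \<lambda>l i j. 0, \<lambda>l i j. 0, \<lambda>l i j. 0)"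
| "galore crd m n r gradF sel x0 \<beta> \<eta> \<tau> B \<omega> (Suc t) =
     (let (x, Pp, Qp, Mp) = galore crd m n r gradF sel x0 \<beta> \<eta> \<tau> B \<omega> t;
          refresh = (t mod \<tau> = 0);
          g = (if refresh then (1 / real B) *\<^sub>R (\<Sum>b<B. gradF x (\<omega> (t, b)))
               else gradF x (\<omega> (t, 0)));
          G = (\<lambda>l. layer crd l g);
          P = (\<lambda>l. if refresh then fst (sel t l (G l)) else Pp l);
          Q = (\<lambda>l. if refresh then snd (sel t l (G l)) else Qp l);
          M = (\<lambda>l. if m l \<le> n l then
                  (\<lambda>i j. (1 - \<beta>) * mmul (r l) (mmul (m l) (tr (P l)) (Pp l)) (Mp l) i j
                         + \<beta> * mmul (m l) (tr (P l)) (G l) i j)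
                else
                  (\<lambda>i j. (1 - \<beta>) * mmul (n l) (mmul (r l) (Mp l) (tr (Qp l))) (Q l) i j
                         + \<beta> * mmul (n l) (G l) (Q l) i j));
          D = (\<lambda>l. if m l \<le> n l then mmul (r l) (P l) (M l) else mmul (r l) (M l) (tr (Q l)));
          x' = (\<chi> k. case crd k of (l, i, j) \<Rightarrow> x $ k - \<eta> * D l i j)
      in (x', P, Q, M))"

definition iterate ::
  "('d \<Rightarrow> nat \<times> nat \<times> nat) \<Rightarrow> (nat \<Rightarrow> nat) \<Rightarrow> (nat \<Rightarrow> nat) \<Rightarrow> (nat \<Rightarrow> nat) \<Rightarrow>
   (real^'d \<Rightarrow> 'b \<Rightarrow> real^'d) \<Rightarrow> (nat \<Rightarrow> nat \<Rightarrow> rmat \<Rightarrow> rmat \<times> rmat) \<Rightarrow>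
   real^'d \<Rightarrow> real \<Rightarrow> real \<Rightarrow> nat \<Rightarrow> nat \<Rightarrow> (nat \<times> nat \<Rightarrow> 'b) \<Rightarrow> nat \<Rightarrow> real^'d" where
  "iterate crd m n r gradF sel x0 \<beta> \<eta> \<tau> B \<omega> t =
     fst (galore crd m n r gradF sel x0 \<beta> \<eta> \<tau> B \<omega> t)"

end

theory Submission
  imports Defs
begin

text \<open>Lifting the compressed momentum back to the full space (\<open>P M\<close> or
  \<open>M Q\<^sup>T\<close>) turns GaLore into projected momentum descent
  \<open>u' = q' ((1 - \<beta>) u + \<beta> g)\<close>, \<open>x' = x - \<eta> u'\<close>, with orthogonal
  projections \<open>q\<close> that change only at refresh steps, where the truncated SVD keeps at least the
  fraction \<open>\<delta>\<close> of the energy of the sampled gradient.  The distance from \<open>u'\<close> to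
  the true gradient splits orthogonally into a momentum error and a projection error.  The projection
  error is at most \<open>(1 - \<delta> / 2)\<close> times the squared gradient norm, plus the drift since
  the last refresh and the batch noise.  The momentum error contracts within a block; at a refresh it
  picks up one squared gradient norm, which is averaged over a neighbouring block and absorbed because
  \<open>\<tau>\<close> is large.  All of this holds for every sample path.  In expectation the only
  unsigned term, the inner product of past quantities with fresh noise, vanishes.\<close>

section \<open>Inequalities in inner product spaces\<close>

text \<open>The obstacle is that the projection chosen at a refresh step is computed from the very
  sample it then acts on, so projected noise need not have mean zero there. The projection is
  therefore never averaged: it is removed by nonexpansiveness before any expectation is taken, and
  the remaining inner product pairs raw noise with a quantity that is already fixed. The price is
  that a refresh compares the momentum with the full gradient and so pays for what the old subspace
  missed. The constants form a budget. After descent, 3/8 of 1/\<eta> times the squared step lengths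
  is available; drift costs 9/64 in the block averaging, 3/160 in the momentum recursion and 1/5 in
  the projection error, together 23/64, each covered by its own condition on \<eta>. The truncated
  SVD yields \<delta>/2 of the squared gradients, the refresh cost takes 9\<delta>/32 of it, and
  half of the remaining 7\<delta>/32 is the factor 7/64 of the pathwise bound. Conditioning on the
  past is replaced by redrawing one coordinate of the product space.\<close>

lemma descent_lemma:
  fixes f :: "'a::real_inner \<Rightarrow> real"
  assumes deriv: "\<And>x. (f has_derivative (\<lambda>h. gradf x \<bullet> h)) (at x)"
    and lip: "\<And>x y. norm (gradf x - gradf y) \<le> L * norm (x - y)"
  shows "f (x + h) \<le> f x + gradf x \<bullet> h + L / 2 * (norm h)\<^sup>2"
proof -
  \<comment> \<open>The asserted bound is \<open>\<phi> 1 \<le> \<phi> 0\<close>. The Lipschitz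
    condition makes the derivative of \<phi> nonpositive on [0, 1], so monotonicity takes the place
    of integrating along the segment.\<close>
  define \<phi> where "\<phi> s = f (x + s *\<^sub>R h) - s * (gradf x \<bullet> h) - L / 2 * s\<^sup>2 * (norm h)\<^sup>2" for s
  have D: "(\<phi> has_real_derivative
      (gradf (x + s *\<^sub>R h) \<bullet> h - gradf x \<bullet> h - L * s * (norm h)\<^sup>2)) (at s)" for s
  proof -
    have "((\<lambda>s. f (x + s *\<^sub>R h)) has_derivative (\<lambda>t. gradf (x + s *\<^sub>R h) \<bullet> (t *\<^sub>R h))) (at s)"
      by (rule has_derivative_compose[OF _ deriv]) (auto intro!: derivative_eq_intros)
    then have "((\<lambda>s. f (x + s *\<^sub>R h)) has_real_derivative (gradf (x + s *\<^sub>R h) \<bullet> h)) (at s)"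
      by (simp add: has_field_derivative_def mult.commute[of _ "gradf (x + s *\<^sub>R h) \<bullet> h"])
    then show ?thesis
      unfolding \<phi>_def by (auto intro!: derivative_eq_intros)
  qed
  have "\<phi> 1 \<le> \<phi> 0"
  proof (rule DERIV_nonpos_imp_nonincreasing[where f = \<phi> and a = 0 and b = 1])
    fix s :: real assume s: "0 \<le> s" "s \<le> 1"
    have "(gradf (x + s *\<^sub>R h) - gradf x) \<bullet> h \<le> norm (gradf (x + s *\<^sub>R h) - gradf x) * norm h"
      by (rule norm_cauchy_schwarz)
    also have "\<dots> \<le> (L * norm (s *\<^sub>R h)) * norm h"
      using lip[of "x + s *\<^sub>R h" x] by (intro mult_right_mono) auto
    finally show "\<exists>y. (\<phi> has_real_derivative y) (at s) \<and> y \<le> 0"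
      using s D[of s] by (auto intro!: exI[of _ "gradf (x + s *\<^sub>R h) \<bullet> h - gradf x \<bullet> h - L * s * (norm h)\<^sup>2"]
          simp: inner_diff_left power2_eq_square algebra_simps)
  qed simp
  then show ?thesis by (simp add: \<phi>_def)
qed

text \<open>Young's inequality: the square of \<open>c *\<^sub>R a - b\<close> is nonnegative. The
  weight \<open>c\<close> is chosen anew at each use, to keep the factor of the first summand close
  to 1 or to balance the two.\<close>

lemma norm_add_sq_le:
  fixes a b :: "'a::real_inner"
  assumes "0 < c"
  shows "(norm (a + b))\<^sup>2 \<le> (1 + c) * (norm a)\<^sup>2 + (1 + 1 / c) * (norm b)\<^sup>2"
proof -
  have "0 \<le> (norm (c *\<^sub>R a - b))\<^sup>2 / c" using assms by simp
  also have "\<dots> = c * (norm a)\<^sup>2 - 2 * (a \<bullet> b) + (norm b)\<^sup>2 / c"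
    using assms unfolding power2_norm_eq_inner
    by (simp add: inner_diff inner_commute field_simps power2_eq_square)
  finally show ?thesis
    unfolding power2_norm_eq_inner by (simp add: inner_add inner_commute algebra_simps)
qed

definition orth_proj :: "('a::real_inner \<Rightarrow> 'a) \<Rightarrow> bool" where
  "orth_proj p \<longleftrightarrow> linear p \<and> (\<forall>v. p (p v) = p v) \<and> (\<forall>v w. p v \<bullet> w = v \<bullet> p w)"

text \<open>Range and kernel of the projection are orthogonal. Two independent vectors are allowed
  because the range part will come from the momentum and the kernel part from the gradient.\<close>

lemma orth_proj_pythagoras:
  assumes "orth_proj p"
  shows "(norm (p v + (w - p w)))\<^sup>2 = (norm (p v))\<^sup>2 + (norm (w - p w))\<^sup>2"
proof -
  have "p v \<bullet> (w - p w) = p v \<bullet> w - v \<bullet> p (p w)"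
    using assms by (simp add: orth_proj_def inner_diff_right)
  also have "\<dots> = 0"
    using assms by (simp add: orth_proj_def)
  finally show ?thesis
    unfolding power2_norm_eq_inner by (simp add: inner_add inner_commute)
qed

lemma orth_proj_norm_sq:
  assumes "orth_proj p"
  shows "(norm w)\<^sup>2 = (norm (p w))\<^sup>2 + (norm (w - p w))\<^sup>2"
  using orth_proj_pythagoras[OF assms, of w w] by simp

lemma orth_proj_norm_le:
  assumes "orth_proj p"
  shows "norm (p w) \<le> norm w" "norm (w - p w) \<le> norm w"
  using orth_proj_norm_sq[OF assms, of w] by (auto intro: power2_le_imp_le)

text \<open>The displacement telescopes, and Cauchy-Schwarz over the steps of a block costs the
  factor \<tau>. Summing over the whole block makes the bound uniform and symmetric in
  \<open>c\<close> and \<open>t\<close>.\<close>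

lemma block_displacement:
  fixes x :: "nat \<Rightarrow> 'a::real_normed_vector"
  assumes "c \<in> {s..<s + \<tau>}" "t \<in> {s..<s + \<tau>}"
  shows "(norm (x c - x t))\<^sup>2 \<le> real \<tau> * (\<Sum>j\<in>{s..<s + \<tau>}. (norm (x (Suc j) - x j))\<^sup>2)"
    (is "_ \<le> _ * ?D")
proof -
  have *: "(norm (x b - x a))\<^sup>2 \<le> real \<tau> * ?D" if "a \<le> b" "a \<in> {s..<s + \<tau>}" "b \<in> {s..<s + \<tau>}" for a b
  proof -
    have "norm (x b - x a) = norm (\<Sum>j\<in>{a..<b}. x (Suc j) - x j)"
      using that by (simp add: sum_Suc_diff')
    also have "\<dots> \<le> (\<Sum>j\<in>{a..<b}. norm (x (Suc j) - x j))"
      by (rule norm_sum)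
    also have "\<dots> \<le> (\<Sum>j\<in>{s..<s + \<tau>}. norm (x (Suc j) - x j))"
      using that by (intro sum_mono2) auto
    finally have "(norm (x b - x a))\<^sup>2 \<le> (\<Sum>j\<in>{s..<s + \<tau>}. norm (x (Suc j) - x j))\<^sup>2"
      by (intro power_mono) auto
    also have "\<dots> \<le> ?D * real (card {s..<s + \<tau>})"
      by (rule sum_squared_le_sum_of_squares)
    finally show ?thesis by (simp add: mult.commute)
  qed
  show ?thesis
    using *[of c t] *[of t c] assms by (cases "c \<le> t") (auto simp: norm_minus_commute)
qed

text \<open>Young's inequality with weight \<beta> / (1 - \<beta>) gives up one of the two factors 1
  - \<beta> to make room for the shift, at the price (1 - \<beta>)^2 / \<beta>, which is at most 1 /
  \<beta>. The weight degenerates at \<beta> = 1, where the left side is zero.\<close>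

lemma convex_shift_sq_le:
  fixes a c :: "'a::real_inner"
  assumes "0 < \<beta>" "\<beta> \<le> 1"
  shows "(1 - \<beta>)\<^sup>2 * (norm (a + c))\<^sup>2 \<le> (1 - \<beta>) * (norm a)\<^sup>2 + (1 / \<beta>) * (norm c)\<^sup>2"
proof (cases "\<beta> = 1")
  case False
  then have w: "0 < 1 - \<beta>" using assms by simp
  have "(1 - \<beta>)\<^sup>2 * (norm (a + c))\<^sup>2
      \<le> (1 - \<beta>)\<^sup>2 * ((1 + \<beta> / (1 - \<beta>)) * (norm a)\<^sup>2 + (1 + 1 / (\<beta> / (1 - \<beta>))) * (norm c)\<^sup>2)"
    using w assms by (intro mult_left_mono norm_add_sq_le) auto
  also have "\<dots> = (1 - \<beta>) * (norm a)\<^sup>2 + (1 - \<beta>)\<^sup>2 * ((1 / \<beta>) * (norm c)\<^sup>2)"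
    using w assms by (simp add: field_simps power2_eq_square)
  also have "\<dots> \<le> (1 - \<beta>) * (norm a)\<^sup>2 + 1 * ((1 / \<beta>) * (norm c)\<^sup>2)"
    using w assms by (intro add_left_mono mult_right_mono) (auto simp: power_le_one)
  finally show ?thesis by simp
qed (use assms in auto)

text \<open>Going from \<open>v\<close> to \<open>g\<close> and back costs a Young factor 1 +
  \<delta>/4 each time. Half of the gain \<delta> survives, since (1 + \<delta>/4)^2 (1 - \<delta>)
  equals 1 - \<delta>/2 minus \<delta>^2 (7/16 + \<delta>/16).\<close>

lemma projection_error_le:
  fixes g v :: "'a::real_inner"
  assumes p: "orth_proj p" and \<delta>: "0 < \<delta>" "\<delta> \<le> 1"
    and g: "(norm (g - p g))\<^sup>2 \<le> (1 - \<delta>) * (norm g)\<^sup>2"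
  shows "(norm (v - p v))\<^sup>2 \<le> (1 - \<delta> / 2) * (norm v)\<^sup>2 + (8 / \<delta>) * (norm (g - v))\<^sup>2"
proof -
  have lin: "linear p" using p by (simp add: orth_proj_def)
  define z where "z = g - v"
  have "(norm (v - p v))\<^sup>2 = (norm ((g - p g) + - (z - p z)))\<^sup>2"
    by (simp add: z_def linear_diff[OF lin])
  also have "\<dots> \<le> (1 + \<delta> / 4) * (norm (g - p g))\<^sup>2 + (1 + 1 / (\<delta> / 4)) * (norm (- (z - p z)))\<^sup>2"
    using \<delta> by (intro norm_add_sq_le) simp
  also have "\<dots> \<le> (1 + \<delta> / 4) * ((1 - \<delta>) * (norm g)\<^sup>2) + (1 + 1 / (\<delta> / 4)) * (norm z)\<^sup>2"
    using \<delta> g orth_proj_norm_le(2)[OF p, of z] norm_minus_cancel[of "z - p z"]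
    by (intro add_mono mult_left_mono power_mono) auto
  also have "\<dots> \<le> (1 + \<delta> / 4) * ((1 - \<delta>) * ((1 + \<delta> / 4) * (norm v)\<^sup>2 + (1 + 1 / (\<delta> / 4)) * (norm z)\<^sup>2))
      + (1 + 1 / (\<delta> / 4)) * (norm z)\<^sup>2"
    using \<delta> norm_add_sq_le[of "\<delta> / 4" v z]
    by (intro add_mono mult_left_mono) (auto simp: z_def)
  also have "\<dots> = ((1 + \<delta> / 4) * (1 - \<delta>) * (1 + \<delta> / 4)) * (norm v)\<^sup>2
      + ((1 + 4 / \<delta>) * ((1 + \<delta> / 4) * (1 - \<delta>) + 1)) * (norm z)\<^sup>2"
    by (simp only: divide_divide_eq_right mult_1 ring_distribs mult.assoc mult.left_commute mult.commute add.assoc)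
  also have "\<dots> \<le> (1 - \<delta> / 2) * (norm v)\<^sup>2 + (8 / \<delta>) * (norm z)\<^sup>2"
  proof (intro add_mono mult_right_mono)
    have "0 \<le> \<delta>\<^sup>2 * (7 / 16 + \<delta> / 16)" using \<delta> by simp
    then show "(1 + \<delta> / 4) * (1 - \<delta>) * (1 + \<delta> / 4) \<le> 1 - \<delta> / 2"
      by (simp add: algebra_simps power2_eq_square)
    \<comment> \<open>Only the term -\<delta>^2/4 is dropped; the product with 1 + 4/\<delta> can
      then be evaluated exactly.\<close>
    have "(1 + \<delta> / 4) * (1 - \<delta>) + 1 \<le> 2 - 3 * \<delta> / 4" using \<delta> by (simp add: algebra_simps)
    then have "(1 + 4 / \<delta>) * ((1 + \<delta> / 4) * (1 - \<delta>) + 1) \<le> (1 + 4 / \<delta>) * (2 - 3 * \<delta> / 4)"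
      using \<delta> by (intro mult_left_mono) auto
    also have "\<dots> = 8 / \<delta> - 1 - 3 * \<delta> / 4" using \<delta> by (simp add: field_simps)
    also have "\<dots> \<le> 8 / \<delta>" using \<delta> by simp
    finally show "(1 + 4 / \<delta>) * ((1 + \<delta> / 4) * (1 - \<delta>) + 1) \<le> 8 / \<delta>" .
  qed auto
  finally show ?thesis by (simp add: z_def)
qed

section \<open>Projected momentum descent along one sample path\<close>

text \<open>Indices are shifted: \<open>u (Suc t)\<close> and \<open>q (Suc t)\<close> are formed at
  step \<open>t\<close> from the sample \<open>g t\<close>, whereas \<open>u t\<close> and
  \<open>q t\<close> precede it. The conditions on \<tau> and \<eta> are cleared of roots and
  denominators.\<close>

locale projected_momentum =
  fixes f :: "'a::real_inner \<Rightarrow> real" and gradf :: "'a \<Rightarrow> 'a"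
    and L \<delta> \<beta> \<eta> :: real and \<tau> :: nat
    and x u g :: "nat \<Rightarrow> 'a" and q :: "nat \<Rightarrow> 'a \<Rightarrow> 'a"
  assumes deriv: "\<And>x. (f has_derivative (\<lambda>h. gradf x \<bullet> h)) (at x)"
    and lip: "\<And>x y. norm (gradf x - gradf y) \<le> L * norm (x - y)"
    and \<delta>: "0 < \<delta>" "\<delta> \<le> 1" and \<beta>: "0 < \<beta>" "\<beta> \<le> 1" and \<eta>: "0 < \<eta>"
    and \<tau>_pos: "0 < \<tau>"
    and \<tau>_ge: "64 \<le> 3 * \<beta> * \<delta> * real \<tau>"
    and \<eta>1: "4 * L * \<eta> \<le> 1"
    and \<eta>2: "80 * L\<^sup>2 * \<eta>\<^sup>2 \<le> 3 * \<delta> * \<beta>\<^sup>2"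
    and \<eta>3: "40 * (real \<tau>)\<^sup>2 * L\<^sup>2 * \<eta>\<^sup>2 \<le> \<delta>"
    and \<eta>4: "32 * real \<tau> * L\<^sup>2 * \<eta>\<^sup>2 \<le> 3 * \<beta>"
    and u_0: "u 0 = 0"
    and u_Suc: "\<And>t. u (Suc t) = q (Suc t) ((1 - \<beta>) *\<^sub>R u t + \<beta> *\<^sub>R g t)"
    and x_Suc: "\<And>t. x (Suc t) = x t - \<eta> *\<^sub>R u (Suc t)"
    and q_proj: "\<And>t. orth_proj (q t)"
    and q_lazy: "\<And>t. t mod \<tau> \<noteq> 0 \<Longrightarrow> q (Suc t) = q t"
    and q_refresh: "\<And>t. t mod \<tau> = 0 \<Longrightarrow>
      (norm (g t - q (Suc t) (g t)))\<^sup>2 \<le> (1 - \<delta>) * (norm (g t))\<^sup>2"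
begin

definition noise :: "nat \<Rightarrow> 'a" where
  "noise t = g t - gradf (x t)"

text \<open>The part of the momentum error at step \<open>t\<close> that is determined before the
  gradient at step \<open>t\<close> is sampled.  At a refresh step the new projection depends on that sample,
  so there it must not occur.\<close>

definition bias :: "nat \<Rightarrow> 'a" where
  "bias t = u t - (if t mod \<tau> = 0 then gradf (x t) else q t (gradf (x t)))"

definition mom_err :: "nat \<Rightarrow> 'a" where
  "mom_err t = u (Suc t) - q (Suc t) (gradf (x t))"

text \<open>The part of the expanded square of
  \<open>(1 - \<beta>) *\<^sub>R bias t + \<beta> *\<^sub>R noise t\<close> that involves the noise.
  The inner product is kept exactly, because only its expectation is controlled.\<close>

definition noise_term :: "nat \<Rightarrow> real" where
  "noise_term t = 2 * \<beta> * (1 - \<beta>) * (bias t \<bullet> noise t) + \<beta>\<^sup>2 * (norm (noise t))\<^sup>2"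

definition step_sq :: "nat \<Rightarrow> real" where
  "step_sq t = (norm (x (Suc t) - x t))\<^sup>2"

text \<open>The cost of a refresh is the gradient at the last step of the previous block, where the
  old subspace was still in use. Truncated subtraction makes \<open>boundary 0\<close> the squared
  gradient at \<open>x 0\<close>, which is the squared initial bias because
  \<open>u 0 = 0\<close>.\<close>

definition boundary :: "nat \<Rightarrow> real" where
  "boundary t = (if t mod \<tau> = 0 then (norm (gradf (x (t - 1))))\<^sup>2 else 0)"

lemma q_linear: "linear (q t)" and q_idem: "q t (q t v) = q t v"
  using q_proj[of t] by (auto simp: orth_proj_def)

lemma grad_diff_sq: "(norm (gradf a - gradf b))\<^sup>2 \<le> L\<^sup>2 * (norm (a - b))\<^sup>2"
  using power_mono[OF lip norm_ge_zero, of a b 2] by (simp add: power_mult_distrib)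

text \<open>Since \<open>u (Suc t)\<close> lies in the range of \<open>q (Suc t)\<close>, so does
  the momentum error, while the rest of the distance lies in the kernel.\<close>

lemma mom_dist:
  "(norm (u (Suc t) - gradf (x t)))\<^sup>2
    = (norm (mom_err t))\<^sup>2 + (norm (gradf (x t) - q (Suc t) (gradf (x t))))\<^sup>2"
proof -
  have "mom_err t = q (Suc t) (mom_err t)"
    by (simp add: mom_err_def u_Suc linear_diff[OF q_linear] q_idem)
  moreover have "u (Suc t) - gradf (x t) = mom_err t - (gradf (x t) - q (Suc t) (gradf (x t)))"
    by (simp add: mom_err_def)
  \<comment> \<open>Pythagoras is available for a sum, so it is applied to the negated momentum
    error; its norm is the same.\<close>
  moreover have "(norm (q (Suc t) (- mom_err t) + (gradf (x t) - q (Suc t) (gradf (x t)))))\<^sup>2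
     = (norm (q (Suc t) (- mom_err t)))\<^sup>2 + (norm (gradf (x t) - q (Suc t) (gradf (x t))))\<^sup>2"
    by (rule orth_proj_pythagoras[OF q_proj])
  ultimately show ?thesis
    by (metis linear_neg[OF q_linear] norm_minus_cancel norm_minus_commute uminus_add_conv_diff)
qed

text \<open>Polarization rewrites the inner product of gradient and momentum, which produces
  1/(2\<eta>) times the squared step length. The quadratic term of the descent lemma takes
  1/(8\<eta>) of it because 4 L \<eta> is at most 1, and 3/(8\<eta>) is left to pay for
  drift.\<close>

lemma descent_step:
  "f (x (Suc t)) + 3 / (8 * \<eta>) * step_sq t + \<eta> / 2 * (norm (gradf (x t)))\<^sup>2
    \<le> f (x t) + \<eta> / 2 * ((norm (mom_err t))\<^sup>2 + (norm (gradf (x t) - q (Suc t) (gradf (x t))))\<^sup>2)"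
proof -
  let ?u = "u (Suc t)" and ?G = "gradf (x t)"
  have d: "step_sq t = \<eta>\<^sup>2 * (norm ?u)\<^sup>2"
    by (simp add: step_sq_def x_Suc power_mult_distrib)
  have "f (x (Suc t)) \<le> f (x t) + ?G \<bullet> (- (\<eta> *\<^sub>R ?u)) + L / 2 * (norm (- (\<eta> *\<^sub>R ?u)))\<^sup>2"
    using descent_lemma[of f gradf L "x t" "- (\<eta> *\<^sub>R ?u)", OF deriv lip] by (simp add: x_Suc)
  also have "\<dots> = f (x t) - \<eta> * (?G \<bullet> ?u) + L / 2 * step_sq t"
    by (simp add: d power_mult_distrib)
  also have "\<eta> * (?G \<bullet> ?u)
      = \<eta> / 2 * ((norm ?G)\<^sup>2 + (norm ?u)\<^sup>2 - (norm (?u - ?G))\<^sup>2)"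
    unfolding power2_norm_eq_inner by (simp add: inner_diff inner_commute algebra_simps)
  also have "\<dots> = \<eta> / 2 * (norm ?G)\<^sup>2 + 1 / (2 * \<eta>) * step_sq t - \<eta> / 2 * (norm (?u - ?G))\<^sup>2"
    using \<eta> by (simp add: d field_simps power2_eq_square)
  finally have "f (x (Suc t)) \<le> f (x t) - \<eta> / 2 * (norm ?G)\<^sup>2 - 1 / (2 * \<eta>) * step_sq t
      + \<eta> / 2 * (norm (?u - ?G))\<^sup>2 + L / 2 * step_sq t" by simp
  moreover have "L / 2 * step_sq t \<le> 1 / (8 * \<eta>) * step_sq t"
    using \<eta>1 \<eta> by (intro mult_right_mono) (auto simp: step_sq_def field_simps)
  moreover have "1 / (2 * \<eta>) * step_sq t = 1 / (8 * \<eta>) * step_sq t + 3 / (8 * \<eta>) * step_sq t"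
    using \<eta> by (simp add: field_simps)
  ultimately show ?thesis by (simp add: mom_dist)
qed

text \<open>Both forms of the bias give the same vector once \<open>q (Suc t)\<close> is applied.
  Dropping that projection can only increase the norm, and it removes the sample-dependent subspace
  from the cross term.\<close>

lemma mom_err_le:
  "(norm (mom_err t))\<^sup>2 \<le> (1 - \<beta>)\<^sup>2 * (norm (bias t))\<^sup>2 + noise_term t"
proof -
  have "mom_err t = q (Suc t) ((1 - \<beta>) *\<^sub>R bias t + \<beta> *\<^sub>R noise t)"
  proof (cases "t mod \<tau> = 0")
    case True
    then have "(1 - \<beta>) *\<^sub>R bias t + \<beta> *\<^sub>R noise t = ((1 - \<beta>) *\<^sub>R u t + \<beta> *\<^sub>R g t) - gradf (x t)"
      by (simp add: bias_def noise_def algebra_simps)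
    then show ?thesis by (simp add: mom_err_def u_Suc linear_diff[OF q_linear])
  next
    case False
    have "(1 - \<beta>) *\<^sub>R bias t + \<beta> *\<^sub>R noise t = ((1 - \<beta>) *\<^sub>R u t + \<beta> *\<^sub>R g t)
       - ((1 - \<beta>) *\<^sub>R q (Suc t) (gradf (x t)) + \<beta> *\<^sub>R gradf (x t))"
      using False by (simp add: bias_def noise_def q_lazy algebra_simps)
    \<comment> \<open>At a lazy step the gradient enters partly projected and partly not;
      idempotence erases the difference.\<close>
    moreover have "q (Suc t) ((1 - \<beta>) *\<^sub>R q (Suc t) (gradf (x t)) + \<beta> *\<^sub>R gradf (x t)) = q (Suc t) (gradf (x t))"
      by (simp add: linear_add[OF q_linear] linear_scale[OF q_linear] q_idem flip: scaleR_add_left)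
    ultimately show ?thesis by (simp add: mom_err_def u_Suc linear_diff[OF q_linear])
  qed
  then have "(norm (mom_err t))\<^sup>2 \<le> (norm ((1 - \<beta>) *\<^sub>R bias t + \<beta> *\<^sub>R noise t))\<^sup>2"
    using orth_proj_norm_le(1)[OF q_proj] by (auto intro: power_mono)
  also have "\<dots> = (1 - \<beta>)\<^sup>2 * (norm (bias t))\<^sup>2 + noise_term t"
    unfolding power2_norm_eq_inner noise_term_def
    by (simp add: inner_add inner_commute power2_eq_square algebra_simps)
  finally show ?thesis .
qed

lemma bias_0_le: "(1 - \<beta>)\<^sup>2 * (norm (bias 0))\<^sup>2 \<le> boundary 0"
proof -
  have "(1 - \<beta>)\<^sup>2 * (norm (bias 0))\<^sup>2 \<le> 1 * (norm (bias 0))\<^sup>2"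
    using \<beta> by (intro mult_right_mono) (auto simp: power_le_one)
  then show ?thesis by (simp add: bias_def u_0 boundary_def)
qed

text \<open>The gradient moves by \<open>c\<close> between consecutive steps, and the loss of one
  factor 1 - \<beta> absorbs this drift. At a refresh the reference becomes the full gradient, so
  \<open>mom_dist\<close> adds the projection error of the old subspace, which is at most the
  gradient itself.\<close>

lemma bias_Suc_le:
  "(1 - \<beta>)\<^sup>2 * (norm (bias (Suc s)))\<^sup>2
    \<le> (1 - \<beta>) * (norm (mom_err s))\<^sup>2 + boundary (Suc s) + L\<^sup>2 / \<beta> * step_sq s"
proof -
  define c where "c = gradf (x s) - gradf (x (Suc s))"
  have c: "(norm c)\<^sup>2 \<le> L\<^sup>2 * step_sq s"
    using grad_diff_sq[of "x s" "x (Suc s)"] by (simp add: c_def step_sq_def norm_minus_commute)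
  show ?thesis
  proof (cases "Suc s mod \<tau> = 0")
    case True
    let ?p = "gradf (x s) - q (Suc s) (gradf (x s))"
    have "bias (Suc s) = (u (Suc s) - gradf (x s)) + c"
      using True by (simp add: bias_def c_def)
    then have "(1 - \<beta>)\<^sup>2 * (norm (bias (Suc s)))\<^sup>2
        \<le> (1 - \<beta>) * (norm (u (Suc s) - gradf (x s)))\<^sup>2 + (1 / \<beta>) * (norm c)\<^sup>2"
      using convex_shift_sq_le[OF \<beta>] by simp
    also have "\<dots> = (1 - \<beta>) * (norm (mom_err s))\<^sup>2 + (1 - \<beta>) * (norm ?p)\<^sup>2 + (1 / \<beta>) * (norm c)\<^sup>2"
      by (simp add: mom_dist algebra_simps)
    also have "\<dots> \<le> (1 - \<beta>) * (norm (mom_err s))\<^sup>2 + 1 * (norm (gradf (x s)))\<^sup>2 + (1 / \<beta>) * (L\<^sup>2 * step_sq s)"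
      using \<beta> c orth_proj_norm_le(2)[OF q_proj]
      by (intro add_mono mult_left_mono mult_mono power_mono) auto
    finally show ?thesis using True by (simp add: boundary_def)
  next
    case False
    have "bias (Suc s) = mom_err s + q (Suc s) c"
      using False by (simp add: bias_def c_def mom_err_def linear_diff[OF q_linear])
    then have "(1 - \<beta>)\<^sup>2 * (norm (bias (Suc s)))\<^sup>2
        \<le> (1 - \<beta>) * (norm (mom_err s))\<^sup>2 + (1 / \<beta>) * (norm (q (Suc s) c))\<^sup>2"
      using convex_shift_sq_le[OF \<beta>] by simp
    also have "(norm (q (Suc s) c))\<^sup>2 \<le> L\<^sup>2 * step_sq s"
      by (rule order_trans[OF power_mono c]) (use orth_proj_norm_le(1)[OF q_proj] in auto)
    finally show ?thesis using False \<beta> by (simp add: boundary_def divide_right_mono)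
  qed
qed

text \<open>The recursion contracts by 1 - \<beta> per step. In the auxiliary inequality the error
  sum on the right stops one step earlier; extending it by a nonnegative term lets it be absorbed on
  the left, where the factor \<beta> remains.\<close>

lemma mom_err_sum:
  "\<beta> * (\<Sum>t<T. (norm (mom_err t))\<^sup>2)
    \<le> (\<Sum>t<T. boundary t) + L\<^sup>2 / \<beta> * (\<Sum>t<T. step_sq t) + (\<Sum>t<T. noise_term t)"
proof -
  have *: "(\<Sum>t<Suc T. (norm (mom_err t))\<^sup>2) \<le> (1 - \<beta>) * (\<Sum>t<T. (norm (mom_err t))\<^sup>2)
     + (\<Sum>t<Suc T. boundary t) + L\<^sup>2 / \<beta> * (\<Sum>t<T. step_sq t) + (\<Sum>t<Suc T. noise_term t)" for T
  proof (induction T)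
    case 0
    show ?case using mom_err_le[of 0] bias_0_le by simp
  next
    case (Suc T)
    show ?case using Suc.IH mom_err_le[of "Suc T"] bias_Suc_le[of T]
      by (simp add: distrib_left)
  qed
  show ?thesis
  proof (cases T)
    case (Suc S)
    have "(1 - \<beta>) * (\<Sum>t<S. (norm (mom_err t))\<^sup>2) \<le> (1 - \<beta>) * (\<Sum>t<T. (norm (mom_err t))\<^sup>2)"
      using \<beta> Suc by (intro mult_left_mono) auto
    moreover have "L\<^sup>2 / \<beta> * (\<Sum>t<S. step_sq t) \<le> L\<^sup>2 / \<beta> * (\<Sum>t<T. step_sq t)"
      using \<beta> Suc by (intro mult_left_mono) (auto simp: step_sq_def)
    ultimately show ?thesis using *[of S] Suc by (simp add: algebra_simps)
  qed simp
qed

section \<open>Averaging over the blocks between refreshes\<close>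

lemma sum_blocks: "(\<Sum>t<K * \<tau>. h t) = (\<Sum>k<K. \<Sum>t\<in>{k * \<tau>..<k * \<tau> + \<tau>}. h t)"
  for h :: "nat \<Rightarrow> real"
  by (rule sum.nat_group[symmetric])

text \<open>The gradient at \<open>c\<close> is compared with the gradient at every \<open>t\<close>
  of the block and the comparisons are averaged, which creates the small factor 1/\<tau>. Young's
  inequality with weight 2 gives the constants 3 and 3/2.\<close>

lemma block_grad_le:
  assumes "c \<in> {s..<s + \<tau>}"
  shows "(norm (gradf (x c)))\<^sup>2 \<le> (3 / real \<tau>) * (\<Sum>t\<in>{s..<s + \<tau>}. (norm (gradf (x t)))\<^sup>2)
     + 3 / 2 * L\<^sup>2 * real \<tau> * (\<Sum>t\<in>{s..<s + \<tau>}. step_sq t)" (is "_ \<le> _ * ?A + _ * ?D")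
proof -
  have "(norm (gradf (x c)))\<^sup>2 \<le> 3 * (norm (gradf (x t)))\<^sup>2 + 3 / 2 * (L\<^sup>2 * (real \<tau> * ?D))"
    if "t \<in> {s..<s + \<tau>}" for t
  proof -
    have "(norm (gradf (x t) + (gradf (x c) - gradf (x t))))\<^sup>2
        \<le> (1 + 2) * (norm (gradf (x t)))\<^sup>2 + (1 + 1 / 2) * (norm (gradf (x c) - gradf (x t)))\<^sup>2"
      by (rule norm_add_sq_le) simp
    also have "\<dots> \<le> 3 * (norm (gradf (x t)))\<^sup>2 + (1 + 1 / 2) * (L\<^sup>2 * (norm (x c - x t))\<^sup>2)"
      by (intro add_mono mult_left_mono grad_diff_sq) auto
    also have "\<dots> \<le> 3 * (norm (gradf (x t)))\<^sup>2 + (1 + 1 / 2) * (L\<^sup>2 * (real \<tau> * ?D))"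
      using block_displacement[OF assms that, of x]
      by (intro add_mono mult_left_mono) (auto simp: step_sq_def)
    finally show ?thesis by simp
  qed
  then have "(\<Sum>t\<in>{s..<s + \<tau>}. (norm (gradf (x c)))\<^sup>2)
      \<le> (\<Sum>t\<in>{s..<s + \<tau>}. 3 * (norm (gradf (x t)))\<^sup>2 + 3 / 2 * (L\<^sup>2 * (real \<tau> * ?D)))"
    by (rule sum_mono)
  then have "real \<tau> * (norm (gradf (x c)))\<^sup>2 \<le> 3 * ?A + real \<tau> * (3 / 2 * (L\<^sup>2 * (real \<tau> * ?D)))"
    by (simp add: sum.distrib sum_distrib_left)
  then have "real \<tau> * (norm (gradf (x c)))\<^sup>2
      \<le> real \<tau> * ((3 / real \<tau>) * ?A + 3 / 2 * L\<^sup>2 * real \<tau> * ?D)"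
    using \<tau>_pos by (simp add: distrib_left mult.assoc)
  then show ?thesis using \<tau>_pos by simp
qed

text \<open>A refresh is charged to the block that it closes. The term at time 0 closes no block and
  is charged to block 0, which exists because \<open>K\<close> is positive. Counting all blocks
  twice covers both charges and doubles the constants of \<open>block_grad_le\<close> to 6 and
  3.\<close>

lemma boundary_sum:
  assumes "1 \<le> K"
  shows "(\<Sum>t<K * \<tau>. boundary t) \<le> (6 / real \<tau>) * (\<Sum>t<K * \<tau>. (norm (gradf (x t)))\<^sup>2)
     + 3 * L\<^sup>2 * real \<tau> * (\<Sum>t<K * \<tau>. step_sq t)"
proof -
  define W where "W k = (3 / real \<tau>) * (\<Sum>t\<in>{k * \<tau>..<k * \<tau> + \<tau>}. (norm (gradf (x t)))\<^sup>2)
     + 3 / 2 * L\<^sup>2 * real \<tau> * (\<Sum>t\<in>{k * \<tau>..<k * \<tau> + \<tau>}. step_sq t)" for k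
  have W0: "0 \<le> W k" for k
    unfolding W_def step_sq_def by (intro add_nonneg_nonneg mult_nonneg_nonneg sum_nonneg) auto
  have block: "(\<Sum>t\<in>{k * \<tau>..<k * \<tau> + \<tau>}. boundary t) = boundary (k * \<tau>)" for k
  proof -
    have "boundary t = 0" if "t \<in> {k * \<tau>..<k * \<tau> + \<tau>} - {k * \<tau>}" for t
    proof -
      have "t mod \<tau> = t - k * \<tau>"
        using that by (intro mod_nat_eqI) auto
      then show ?thesis using that by (auto simp: boundary_def)
    qed
    then show ?thesis
      using \<tau>_pos by (subst sum.mono_neutral_right[of _ "{k * \<tau>}"]) auto
  qed
  have first: "boundary (0 * \<tau>) \<le> W 0"
    using block_grad_le[of 0 0] \<tau>_pos by (simp add: boundary_def W_def)
  have later: "boundary (Suc k * \<tau>) \<le> W k" for k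
  proof -
    \<comment> \<open>The step just before a refresh is the last one of the preceding block.\<close>
    have "Suc k * \<tau> - 1 \<in> {k * \<tau>..<k * \<tau> + \<tau>}" using \<tau>_pos by auto
    from block_grad_le[OF this] show ?thesis by (simp add: boundary_def W_def)
  qed
  obtain K' where K': "K = Suc K'" using assms by (cases K) auto
  have "(\<Sum>t<K * \<tau>. boundary t) = (\<Sum>k<K. boundary (k * \<tau>))"
    by (simp only: sum_blocks block)
  also have "\<dots> = boundary (0 * \<tau>) + (\<Sum>k<K'. boundary (Suc k * \<tau>))"
    unfolding K' by (rule sum.lessThan_Suc_shift)
  also have "\<dots> \<le> W 0 + (\<Sum>k<K'. W k)"
    by (intro add_mono first sum_mono later)
  also have "\<dots> \<le> (\<Sum>k<K. W k) + (\<Sum>k<K. W k)"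
    using W0 member_le_sum[of 0 "{..<K}" W] by (intro add_mono sum_mono2) (auto simp: K')
  also have "\<dots> = (6 / real \<tau>) * (\<Sum>t<K * \<tau>. (norm (gradf (x t)))\<^sup>2)
     + 3 * L\<^sup>2 * real \<tau> * (\<Sum>t<K * \<tau>. step_sq t)"
    unfolding W_def sum.distrib sum_distrib_left[symmetric] sum_blocks[symmetric]
    by (simp add: algebra_simps)
  finally show ?thesis .
qed

lemma q_block: "t \<in> {k * \<tau>..<k * \<tau> + \<tau>} \<Longrightarrow> q (Suc t) = q (Suc (k * \<tau>))"
proof (induction "t - k * \<tau>" arbitrary: t)
  case (Suc d)
  then obtain s where t: "t = Suc s" by (cases t) auto
  have "t mod \<tau> = t - k * \<tau>"
    using Suc.prems by (intro mod_nat_eqI) auto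
  then have "q (Suc t) = q t" using Suc.hyps by (intro q_lazy) auto
  moreover have "q (Suc s) = q (Suc (k * \<tau>))"
    using Suc.hyps Suc.prems t by (intro Suc.hyps(1)) auto
  ultimately show ?case using t by simp
qed auto

text \<open>Throughout a block the subspace comes from the gradient sampled at its start, which
  differs from the current gradient by drift plus batch noise. Splitting the two doubles 8/\<delta>
  to 16/\<delta>, and the single batch noise is counted once for each of the \<tau> steps.\<close>

lemma proj_err_sum:
  "(\<Sum>t<K * \<tau>. (norm (gradf (x t) - q (Suc t) (gradf (x t))))\<^sup>2)
    \<le> (1 - \<delta> / 2) * (\<Sum>t<K * \<tau>. (norm (gradf (x t)))\<^sup>2)
      + 16 / \<delta> * (L\<^sup>2 * (real \<tau>)\<^sup>2 * (\<Sum>t<K * \<tau>. step_sq t) + real \<tau> * (\<Sum>k<K. (norm (noise (k * \<tau>)))\<^sup>2))"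
proof -
  have block: "(\<Sum>t\<in>{k * \<tau>..<k * \<tau> + \<tau>}. (norm (gradf (x t) - q (Suc t) (gradf (x t))))\<^sup>2)
    \<le> (1 - \<delta> / 2) * (\<Sum>t\<in>{k * \<tau>..<k * \<tau> + \<tau>}. (norm (gradf (x t)))\<^sup>2)
      + 16 / \<delta> * (L\<^sup>2 * (real \<tau>)\<^sup>2 * (\<Sum>t\<in>{k * \<tau>..<k * \<tau> + \<tau>}. step_sq t) + real \<tau> * (norm (noise (k * \<tau>)))\<^sup>2)"
    (is "_ \<le> _ * ?A + _ * (_ * ?D + _ * ?N)") for k
  proof -
    let ?s = "k * \<tau>"
    have "(norm (gradf (x t) - q (Suc t) (gradf (x t))))\<^sup>2
        \<le> (1 - \<delta> / 2) * (norm (gradf (x t)))\<^sup>2 + 8 / \<delta> * (2 * (L\<^sup>2 * (real \<tau> * ?D)) + 2 * ?N)"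
      if t: "t \<in> {?s..<?s + \<tau>}" for t
    proof -
      have "(norm (gradf (x t) - q (Suc t) (gradf (x t))))\<^sup>2
          \<le> (1 - \<delta> / 2) * (norm (gradf (x t)))\<^sup>2 + 8 / \<delta> * (norm (g ?s - gradf (x t)))\<^sup>2"
        unfolding q_block[OF t]
        using q_refresh[of ?s] by (intro projection_error_le q_proj \<delta>) auto
      also have "(norm (g ?s - gradf (x t)))\<^sup>2 = (norm ((gradf (x ?s) - gradf (x t)) + noise ?s))\<^sup>2"
        by (simp add: noise_def)
      also have "\<dots> \<le> (1 + 1) * (norm (gradf (x ?s) - gradf (x t)))\<^sup>2 + (1 + 1 / 1) * ?N"
        by (rule norm_add_sq_le) simp
      also have "\<dots> \<le> (1 + 1) * (L\<^sup>2 * (norm (x ?s - x t))\<^sup>2) + (1 + 1 / 1) * ?N"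
        by (intro add_mono mult_left_mono grad_diff_sq) auto
      also have "\<dots> \<le> (1 + 1) * (L\<^sup>2 * (real \<tau> * ?D)) + (1 + 1 / 1) * ?N"
        using block_displacement[of ?s ?s \<tau> t x] t \<tau>_pos
        by (intro add_mono mult_left_mono) (auto simp: step_sq_def)
      finally show ?thesis using \<delta> by (simp add: mult_left_mono divide_right_mono)
    qed
    then have "(\<Sum>t\<in>{?s..<?s + \<tau>}. (norm (gradf (x t) - q (Suc t) (gradf (x t))))\<^sup>2)
      \<le> (\<Sum>t\<in>{?s..<?s + \<tau>}. (1 - \<delta> / 2) * (norm (gradf (x t)))\<^sup>2 + 8 / \<delta> * (2 * (L\<^sup>2 * (real \<tau> * ?D)) + 2 * ?N))"
      by (rule sum_mono)
    also have "\<dots> = (1 - \<delta> / 2) * ?A + real \<tau> * (8 / \<delta> * (2 * (L\<^sup>2 * (real \<tau> * ?D)) + 2 * ?N))"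
      by (simp add: sum.distrib sum_distrib_left)
    also have "\<dots> = (1 - \<delta> / 2) * ?A + 16 / \<delta> * (L\<^sup>2 * (real \<tau>)\<^sup>2 * ?D + real \<tau> * ?N)"
      by (simp add: algebra_simps power2_eq_square)
    finally show ?thesis .
  qed
  show ?thesis
    unfolding sum_blocks
    by (rule order_trans[OF sum_mono[OF block]]) (simp add: sum.distrib sum_distrib_left distrib_left)
qed

text \<open>The telescoped descent inequality is combined with the two error sums. The noise sums
  are carried along unestimated, since they are bounded only in expectation.\<close>

theorem path_bound:
  assumes K: "1 \<le> K"
  shows "7 / 64 * \<eta> * \<delta> * (\<Sum>t<K * \<tau>. (norm (gradf (x t)))\<^sup>2)
    \<le> f (x 0) - f (x (K * \<tau>)) + \<eta> / 2 * (16 * real \<tau> / \<delta> * (\<Sum>k<K. (norm (noise (k * \<tau>)))\<^sup>2)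
        + 1 / \<beta> * (\<Sum>t<K * \<tau>. noise_term t))"
proof -
  define A where "A = (\<Sum>t<K * \<tau>. (norm (gradf (x t)))\<^sup>2)"
  define D where "D = (\<Sum>t<K * \<tau>. step_sq t)"
  define E where "E = (\<Sum>t<K * \<tau>. (norm (mom_err t))\<^sup>2)"
  define P where "P = (\<Sum>t<K * \<tau>. (norm (gradf (x t) - q (Suc t) (gradf (x t))))\<^sup>2)"
  define N where "N = (\<Sum>k<K. (norm (noise (k * \<tau>)))\<^sup>2)"
  define Z where "Z = (\<Sum>t<K * \<tau>. noise_term t)"
  have A0: "0 \<le> A" and D0: "0 \<le> D"
    by (auto simp: A_def D_def step_sq_def intro!: sum_nonneg)
  have "(\<Sum>t<T. f (x (Suc t)) - f (x t)) = f (x T) - f (x 0)" for T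
    by (rule sum_lessThan_telescope)
  moreover have "(\<Sum>t<K * \<tau>. f (x (Suc t)) - f (x t) + 3 / (8 * \<eta>) * step_sq t + \<eta> / 2 * (norm (gradf (x t)))\<^sup>2)
      \<le> (\<Sum>t<K * \<tau>. \<eta> / 2 * ((norm (mom_err t))\<^sup>2 + (norm (gradf (x t) - q (Suc t) (gradf (x t))))\<^sup>2))"
    using descent_step by (intro sum_mono) (simp add: algebra_simps)
  ultimately have descent: "f (x (K * \<tau>)) - f (x 0) + 3 / (8 * \<eta>) * D + \<eta> / 2 * A \<le> \<eta> / 2 * (E + P)"
    unfolding sum.distrib sum_distrib_left[symmetric] A_def D_def E_def P_def by simp
  have P: "P \<le> (1 - \<delta> / 2) * A + 16 / \<delta> * (L\<^sup>2 * (real \<tau>)\<^sup>2 * D + real \<tau> * N)"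
    unfolding P_def A_def D_def N_def by (rule proj_err_sum)
  have "\<beta> * E \<le> (6 / real \<tau>) * A + 3 * L\<^sup>2 * real \<tau> * D + L\<^sup>2 / \<beta> * D + Z"
    using mom_err_sum[of "K * \<tau>"] boundary_sum[OF K] by (simp add: A_def D_def E_def Z_def)
  then have "E \<le> ((6 / real \<tau>) * A + 3 * L\<^sup>2 * real \<tau> * D + L\<^sup>2 / \<beta> * D + Z) / \<beta>"
    using \<beta> by (simp add: pos_le_divide_eq mult.commute)
  then have E: "E \<le> 6 / (real \<tau> * \<beta>) * A + 3 * L\<^sup>2 * real \<tau> / \<beta> * D + L\<^sup>2 / \<beta>\<^sup>2 * D + 1 / \<beta> * Z"
    by (simp add: add_divide_distrib power2_eq_square)
  have "\<eta> / 2 * (E + P) \<le> \<eta> / 2 * ((6 / (real \<tau> * \<beta>) * A + 3 * L\<^sup>2 * real \<tau> / \<beta> * D + L\<^sup>2 / \<beta>\<^sup>2 * D + 1 / \<beta> * Z)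
     + ((1 - \<delta> / 2) * A + 16 / \<delta> * (L\<^sup>2 * (real \<tau>)\<^sup>2 * D + real \<tau> * N)))"
    using \<eta> E P by (intro mult_left_mono add_mono) auto
  also have "\<dots> = \<eta> / 2 * (1 - \<delta> / 2) * A + \<eta> / 2 * (6 / (real \<tau> * \<beta>)) * A
     + (\<eta> / 2 * (3 * L\<^sup>2 * real \<tau> / \<beta>)) * D + (\<eta> / 2 * (L\<^sup>2 / \<beta>\<^sup>2)) * D
     + (\<eta> / 2 * (16 / \<delta> * (L\<^sup>2 * (real \<tau>)\<^sup>2))) * D
     + \<eta> / 2 * (16 * real \<tau> / \<delta> * N + 1 / \<beta> * Z)"
    by (simp add: algebra_simps)
  also have "\<dots> \<le> \<eta> / 2 * (1 - \<delta> / 2) * A + \<eta> / 2 * (9 * \<delta> / 32) * A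
     + (9 / (64 * \<eta>)) * D + (3 / (160 * \<eta>)) * D + (1 / (5 * \<eta>)) * D
     + \<eta> / 2 * (16 * real \<tau> / \<delta> * N + 1 / \<beta> * Z)"
  proof -
    \<comment> \<open>The lower bound on \<tau> gives 6/(\<tau>\<beta>) at most
      18\<delta>/64.\<close>
    have 1: "\<eta> / 2 * (6 / (real \<tau> * \<beta>)) \<le> \<eta> / 2 * (9 * \<delta> / 32)"
      using \<tau>_ge \<tau>_pos \<beta> \<eta> by (intro mult_left_mono) (auto simp: field_simps)
    have 2: "\<eta> / 2 * (3 * L\<^sup>2 * real \<tau> / \<beta>) \<le> 9 / (64 * \<eta>)"
      using \<eta>4 \<eta> \<beta> by (simp add: field_simps power2_eq_square)
    \<comment> \<open>Here \<delta> is relaxed to 1; half of 3/80 then gives the constant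
      3/160.\<close>
    have "80 * L\<^sup>2 * \<eta>\<^sup>2 \<le> 3 * \<beta>\<^sup>2"
      using \<eta>2 \<delta> mult_right_mono[of \<delta> 1 "3 * \<beta>\<^sup>2"] by (simp add: mult.commute mult.left_commute)
    then have 3: "\<eta> / 2 * (L\<^sup>2 / \<beta>\<^sup>2) \<le> 3 / (160 * \<eta>)"
      using \<eta> \<beta> by (simp add: field_simps power2_eq_square)
    have 4: "\<eta> / 2 * (16 / \<delta> * (L\<^sup>2 * (real \<tau>)\<^sup>2)) \<le> 1 / (5 * \<eta>)"
      using \<eta>3 \<eta> \<delta> by (simp add: field_simps power2_eq_square)
    show ?thesis
      by (intro add_mono order_refl mult_right_mono[OF 1 A0] mult_right_mono[OF 2 D0]
          mult_right_mono[OF 3 D0] mult_right_mono[OF 4 D0])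
  qed
  finally have "\<eta> / 2 * (E + P) \<le> \<eta> / 2 * (1 - \<delta> / 2) * A + \<eta> / 2 * (9 * \<delta> / 32) * A
     + (9 / (64 * \<eta>)) * D + (3 / (160 * \<eta>)) * D + (1 / (5 * \<eta>)) * D
     + \<eta> / 2 * (16 * real \<tau> / \<delta> * N + 1 / \<beta> * Z)" .
  moreover have "(9 / (64 * \<eta>)) * D + (3 / (160 * \<eta>)) * D + (1 / (5 * \<eta>)) * D \<le> 3 / (8 * \<eta>) * D"
    using \<eta> D0 by (simp add: field_simps)
  moreover have "7 / 64 * \<eta> * \<delta> * A = \<eta> / 2 * A - (\<eta> / 2 * (1 - \<delta> / 2) * A + \<eta> / 2 * (9 * \<delta> / 32) * A)"
    by (simp add: field_simps)
  ultimately show ?thesis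
    using descent unfolding A_def[symmetric] N_def[symmetric] Z_def[symmetric] by linarith
qed

end

section \<open>Truncated singular value decompositions, layer by layer\<close>

definition orthonormal_cols :: "nat \<Rightarrow> nat \<Rightarrow> rmat \<Rightarrow> bool" where
  "orthonormal_cols k r P \<longleftrightarrow>
     (\<forall>a<r. \<forall>b<r. (\<Sum>i<k. P i a * P i b) = (if a = b then 1 else 0))"

text \<open>The vector P (P^T w), with the first \<open>r\<close> columns of \<open>P\<close>. It
  serves columns of a matrix as well as rows, the latter with \<open>Q\<close> in the place of
  \<open>P\<close>.\<close>

definition col_proj :: "nat \<Rightarrow> nat \<Rightarrow> rmat \<Rightarrow> (nat \<Rightarrow> real) \<Rightarrow> nat \<Rightarrow> real" where
  "col_proj k r P w = (\<lambda>i. \<Sum>a<r. P i a * (\<Sum>i'<k. P i' a * w i'))"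

lemma col_proj_cong: "(\<And>i'. i' < k \<Longrightarrow> w i' = z i') \<Longrightarrow> col_proj k r P w i = col_proj k r P z i"
  by (simp add: col_proj_def)

lemma col_proj_add: "col_proj k r P (\<lambda>i. w i + z i) i = col_proj k r P w i + col_proj k r P z i"
  by (simp add: col_proj_def distrib_left sum.distrib)

lemma col_proj_scale: "col_proj k r P (\<lambda>i. c * w i) i = c * col_proj k r P w i"
  by (simp add: col_proj_def sum_distrib_left mult_ac)

text \<open>The right side is symmetric in \<open>w\<close> and \<open>z\<close>, from which
  self-adjointness can be read off.\<close>

lemma col_proj_inner:
  "(\<Sum>i<k. col_proj k r P w i * z i) = (\<Sum>a<r. (\<Sum>i<k. P i a * w i) * (\<Sum>i<k. P i a * z i))"
proof -
  define c where "c a = (\<Sum>i<k. P i a * w i)" for a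
  have "(\<Sum>i<k. col_proj k r P w i * z i) = (\<Sum>i<k. \<Sum>a<r. P i a * c a * z i)"
    by (simp add: col_proj_def c_def[symmetric] sum_distrib_right)
  also have "\<dots> = (\<Sum>a<r. \<Sum>i<k. P i a * c a * z i)"
    by (rule sum.swap)
  finally show ?thesis unfolding c_def[symmetric] by (simp add: sum_distrib_left mult_ac)
qed

lemma col_proj_self_adjoint:
  "(\<Sum>i<k. col_proj k r P w i * z i) = (\<Sum>i<k. w i * col_proj k r P z i)"
  using col_proj_inner[of k r P w z] col_proj_inner[of k r P z w] by (simp add: mult.commute)

lemma orthonormal_cols_coeff:
  assumes "orthonormal_cols k r P" "a < r"
  shows "(\<Sum>i<k. P i a * (\<Sum>b<r. P i b * c b)) = c a"
proof -
  have "(\<Sum>i<k. P i a * (\<Sum>b<r. P i b * c b)) = (\<Sum>i<k. \<Sum>b<r. P i a * P i b * c b)"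
    by (simp add: sum_distrib_left mult_ac)
  also have "\<dots> = (\<Sum>b<r. \<Sum>i<k. P i a * P i b * c b)"
    by (rule sum.swap)
  also have "\<dots> = (\<Sum>b<r. (if a = b then 1 else 0) * c b)"
    using assms by (simp add: orthonormal_cols_def flip: sum_distrib_right)
  also have "\<dots> = c a" using assms by (simp add: if_distrib[of "\<lambda>x. x * _"] cong: if_cong)
  finally show ?thesis .
qed

lemma col_proj_idem:
  assumes "orthonormal_cols k r P \<or> P = (\<lambda>i j. 0)"
  shows "col_proj k r P (col_proj k r P w) i = col_proj k r P w i"
  using assms
proof
  assume "orthonormal_cols k r P"
  from orthonormal_cols_coeff[OF this] show ?thesis by (simp add: col_proj_def)
qed (simp add: col_proj_def)

lemma col_proj_sq:
  assumes "orthonormal_cols k r P"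
  shows "(\<Sum>i<k. (col_proj k r P w i)\<^sup>2) = (\<Sum>a<r. (\<Sum>i<k. P i a * w i)\<^sup>2)"
  using col_proj_self_adjoint[of k r P w "col_proj k r P w"] col_proj_idem[of k r P w] assms
    col_proj_inner[of k r P w w]
  by (simp add: power2_eq_square mult.commute)

text \<open>The mean of the largest \<open>r\<close> values is at least the overall mean: each tail
  value is compared with each prefix value, over all pairs.\<close>

lemma decreasing_prefix_sum:
  fixes s :: "nat \<Rightarrow> real"
  assumes "r \<le> p" and dec: "\<And>i j. i \<le> j \<Longrightarrow> j < p \<Longrightarrow> s j \<le> s i"
  shows "real r * (\<Sum>a<p. s a) \<le> real p * (\<Sum>a<r. s a)"
proof -
  have split: "(\<Sum>a<p. s a) = (\<Sum>a<r. s a) + (\<Sum>a\<in>{r..<p}. s a)"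
    using assms(1) by (metis atLeast0LessThan le0 sum.atLeastLessThan_concat)
  have "real r * (\<Sum>b\<in>{r..<p}. s b) = (\<Sum>a<r. \<Sum>b\<in>{r..<p}. s b)"
    by simp
  also have "\<dots> \<le> (\<Sum>a<r. \<Sum>b\<in>{r..<p}. s a)"
    using dec by (intro sum_mono) auto
  also have "\<dots> = (real p - real r) * (\<Sum>a<r. s a)"
    using assms(1) by (simp add: sum_distrib_left of_nat_diff)
  finally show ?thesis by (simp add: split algebra_simps)
qed

text \<open>With \<open>G = U diag(s) V\<^sup>T\<close>, both sides are sums of squared singular values: all \<open>p\<close>
  of them on the left, the \<open>r\<close> largest on the right.\<close>

lemma truncation_energy:
  assumes U: "orthonormal_cols m p U" and V: "orthonormal_cols n p V"
    and G: "\<And>i j. i < m \<Longrightarrow> j < n \<Longrightarrow> G i j = (\<Sum>k<p. U i k * (s k * V j k))"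
    and s: "\<And>i. i < p \<Longrightarrow> 0 \<le> s i" "\<And>i. Suc i < p \<Longrightarrow> s (Suc i) \<le> s i"
    and r: "r \<le> p"
  shows "real r * (\<Sum>j<n. \<Sum>i<m. (G i j)\<^sup>2) \<le> real p * (\<Sum>j<n. \<Sum>i<m. (col_proj m r U (\<lambda>i. G i j) i)\<^sup>2)"
proof -
  have coeff: "(\<Sum>i<m. U i a * G i j) = s a * V j a" if "a < p" "j < n" for a j
    using orthonormal_cols_coeff[OF U that(1), of "\<lambda>k. s k * V j k"] that by (simp add: G)
  have energy: "(\<Sum>j<n. \<Sum>i<m. (col_proj m r' U (\<lambda>i. G i j) i)\<^sup>2) = (\<Sum>a<r'. (s a)\<^sup>2)" if "r' \<le> p" for r'
  proof -
    have U': "orthonormal_cols m r' U" using U that by (simp add: orthonormal_cols_def)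
    have V1: "(\<Sum>j<n. (V j a)\<^sup>2) = 1" if "a < p" for a
      using V that by (simp add: orthonormal_cols_def power2_eq_square)
    have "(\<Sum>j<n. \<Sum>i<m. (col_proj m r' U (\<lambda>i. G i j) i)\<^sup>2) = (\<Sum>j<n. \<Sum>a<r'. (s a)\<^sup>2 * (V j a)\<^sup>2)"
      using coeff that by (simp add: col_proj_sq[OF U'] power_mult_distrib)
    also have "\<dots> = (\<Sum>a<r'. \<Sum>j<n. (s a)\<^sup>2 * (V j a)\<^sup>2)" by (rule sum.swap)
    also have "\<dots> = (\<Sum>a<r'. (s a)\<^sup>2)"
      using V1 that by (simp flip: sum_distrib_left)
    finally show ?thesis .
  qed
  \<comment> \<open>With all \<open>p\<close> columns the projection fixes \<open>G\<close>, whose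
    columns lie in their span, so the energy formula at \<open>p\<close> computes the full Frobenius
    norm.\<close>
  have "col_proj m p U (\<lambda>i. G i j) i = G i j" if "i < m" "j < n" for i j
    using coeff that by (simp add: col_proj_def G)
  then have full: "(\<Sum>j<n. \<Sum>i<m. (G i j)\<^sup>2) = (\<Sum>a<p. (s a)\<^sup>2)"
    using energy[of p] by simp
  have "s j \<le> s i" if "i \<le> j" "j < p" for i j
    using that by (induction j rule: dec_induct) (use s(2) in \<open>auto intro: order_trans\<close>)
  then have "real r * (\<Sum>a<p. (s a)\<^sup>2) \<le> real p * (\<Sum>a<r. (s a)\<^sup>2)"
    using s(1) r by (intro decreasing_prefix_sum power_mono) auto
  then show ?thesis by (simp add: full energy[OF r])
qed

text \<open>A rectangular diagonal \<open>S\<close> has no entries beyond min m n, so the full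
  decomposition collapses to the thin form required by \<open>truncation_energy\<close>; for
  \<open>n < m\<close> the rows \<open>k \<ge> n\<close> of \<open>S\<close> vanish.\<close>

lemma svd_sum_min:
  assumes "is_svd m n G U S V" "i < m" "j < n"
  shows "G i j = (\<Sum>k<min m n. U i k * (S k k * V j k))"
proof -
  have S: "S k l = 0" if "k < m" "l < n" "k \<noteq> l" for k l
    using assms(1) that by (auto simp: is_svd_def)
  have "G i j = (\<Sum>k<m. \<Sum>l<n. U i k * S k l * V j l)"
    using assms by (auto simp: is_svd_def)
  also have "\<dots> = (\<Sum>k<m. if k < n then U i k * (S k k * V j k) else 0)"
  proof (intro sum.cong refl)
    fix k assume "k \<in> {..<m}"
    then have "(\<Sum>l<n. U i k * S k l * V j l) = (\<Sum>l<n. if l = k then U i k * S k k * V j k else 0)"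
      using S[of k] by (intro sum.cong refl) auto
    then show "(\<Sum>l<n. U i k * S k l * V j l) = (if k < n then U i k * (S k k * V j k) else 0)"
      by (simp add: mult.assoc)
  qed
  also have "\<dots> = (\<Sum>k\<in>{..<m} \<inter> {k. k < n}. U i k * (S k k * V j k))"
    by (simp add: sum.If_cases)
  also have "{..<m} \<inter> {k. k < n} = {..<min m n}" by auto
  finally show ?thesis .
qed

text \<open>Since \<open>P\<close> and \<open>Q\<close> agree with \<open>U\<close> and
  \<open>V\<close> on the retained columns, the truncation estimate transfers. A wide matrix is
  projected column by column, a tall one row by row, and min m n is the dimension being
  projected.\<close>

lemma svd_trunc_energy:
  assumes "svd_trunc m n r G P Q" and r: "r \<le> min m n"
  shows "m \<le> n \<Longrightarrow> orthonormal_cols m r P \<and>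
      real r * (\<Sum>j<n. \<Sum>i<m. (G i j)\<^sup>2) \<le> real m * (\<Sum>j<n. \<Sum>i<m. (col_proj m r P (\<lambda>i. G i j) i)\<^sup>2)"
    and "n < m \<Longrightarrow> orthonormal_cols n r Q \<and>
      real r * (\<Sum>i<m. \<Sum>j<n. (G i j)\<^sup>2) \<le> real n * (\<Sum>i<m. \<Sum>j<n. (col_proj n r Q (G i) j)\<^sup>2)"
proof -
  obtain U S V where svd: "is_svd m n G U S V"
    and P: "\<And>i j. i < m \<Longrightarrow> j < r \<Longrightarrow> P i j = U i j" and Q: "\<And>i j. i < n \<Longrightarrow> j < r \<Longrightarrow> Q i j = V i j"
    using assms(1) unfolding svd_trunc_def by blast
  let ?p = "min m n"
  have U: "orthonormal_cols m k U" if "k \<le> m" for k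
    using svd that by (simp add: is_svd_def orthogonal_mat_def orthonormal_cols_def)
  have V: "orthonormal_cols n k V" if "k \<le> n" for k
    using svd that by (simp add: is_svd_def orthogonal_mat_def orthonormal_cols_def)
  have s: "\<And>i. i < ?p \<Longrightarrow> 0 \<le> S i i" "\<And>i. Suc i < ?p \<Longrightarrow> S (Suc i) (Suc i) \<le> S i i"
    using svd by (auto simp: is_svd_def)
  note G = svd_sum_min[OF svd]
  have "orthonormal_cols m r P"
    using U[of r] r P by (simp add: orthonormal_cols_def)
  moreover have "col_proj m r P w i = col_proj m r U w i" if "i < m" for w i
    using P that by (simp add: col_proj_def)
  moreover have "real r * (\<Sum>j<n. \<Sum>i<m. (G i j)\<^sup>2) \<le> real ?p * (\<Sum>j<n. \<Sum>i<m. (col_proj m r U (\<lambda>i. G i j) i)\<^sup>2)"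
    by (rule truncation_energy[OF U V G s r]) auto
  ultimately show "m \<le> n \<Longrightarrow> orthonormal_cols m r P \<and>
      real r * (\<Sum>j<n. \<Sum>i<m. (G i j)\<^sup>2) \<le> real m * (\<Sum>j<n. \<Sum>i<m. (col_proj m r P (\<lambda>i. G i j) i)\<^sup>2)"
    by simp
  have "orthonormal_cols n r Q"
    using V[of r] r Q by (simp add: orthonormal_cols_def)
  moreover have "col_proj n r Q w i = col_proj n r V w i" if "i < n" for w i
    using Q that by (simp add: col_proj_def)
  \<comment> \<open>The same estimate for the transpose of \<open>G\<close>, which exchanges
    \<open>U\<close> and \<open>V\<close>.\<close>
  moreover have "real r * (\<Sum>i<m. \<Sum>j<n. (G i j)\<^sup>2) \<le> real ?p * (\<Sum>i<m. \<Sum>j<n. (col_proj n r V (G i) j)\<^sup>2)"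
    using r by (intro truncation_energy[OF V U, of ?p "\<lambda>j i. G i j" "\<lambda>k. S k k"])
       (auto simp: G s mult_ac simp del: min_less_iff_conj)
  ultimately show "n < m \<Longrightarrow> orthonormal_cols n r Q \<and>
      real r * (\<Sum>i<m. \<Sum>j<n. (G i j)\<^sup>2) \<le> real n * (\<Sum>i<m. \<Sum>j<n. (col_proj n r Q (G i) j)\<^sup>2)"
    by simp
qed

section \<open>Splitting the parameter vector into layers\<close>

locale layered =
  fixes NL :: nat and m n r :: "nat \<Rightarrow> nat" and crd :: "'d::finite \<Rightarrow> nat \<times> nat \<times> nat"
  assumes crd: "bij_betw crd UNIV {(l, i, j). l < NL \<and> i < m l \<and> j < n l}"
    and rank: "\<And>l. l < NL \<Longrightarrow> 0 < r l \<and> r l < min (m l) (n l)"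
begin

definition ratio :: real where
  "ratio = Min ((\<lambda>l. real (r l) / real (min (m l) (n l))) ` {..<NL})"

definition unlayer :: "(nat \<Rightarrow> rmat) \<Rightarrow> real^'d" where
  "unlayer A = (\<chi> k. case crd k of (l, i, j) \<Rightarrow> A l i j)"

definition layer_proj :: "(nat \<Rightarrow> rmat) \<Rightarrow> (nat \<Rightarrow> rmat) \<Rightarrow> real^'d \<Rightarrow> real^'d" where
  "layer_proj P Q v = unlayer (\<lambda>l i j.
     if m l \<le> n l then col_proj (m l) (r l) (P l) (\<lambda>i. layer crd l v i j) i
     else col_proj (n l) (r l) (Q l) (layer crd l v i) j)"

definition lift_mom :: "(nat \<Rightarrow> rmat) \<Rightarrow> (nat \<Rightarrow> rmat) \<Rightarrow> (nat \<Rightarrow> rmat) \<Rightarrow> real^'d" where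
  "lift_mom P Q M = unlayer (\<lambda>l. if m l \<le> n l then mmul (r l) (P l) (M l) else mmul (r l) (M l) (tr (Q l)))"

lemma crd_bounds: "crd k = (l, i, j) \<Longrightarrow> l < NL \<and> i < m l \<and> j < n l"
  using bij_betw_apply[OF crd UNIV_I, of k] by auto

text \<open>The index type \<open>'d\<close> is nonempty, so any coordinate, here
  \<open>undefined\<close>, belongs to some layer. This makes the minimum in \<open>ratio\<close>
  range over a nonempty set.\<close>

lemma NL_pos: "0 < NL"
  using crd_bounds[of undefined] by (cases "crd undefined") auto

lemma layer_unlayer:
  assumes "l < NL" "i < m l" "j < n l"
  shows "layer crd l (unlayer A) i j = A l i j"
proof -
  have "crd (inv crd (l, i, j)) = (l, i, j)"
    using assms crd by (intro f_inv_into_f) (auto simp: bij_betw_def)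
  then show ?thesis by (simp add: layer_def unlayer_def)
qed

lemma unlayer_layer: "unlayer (\<lambda>l. layer crd l v) = v"
proof -
  have "inj crd" using crd by (simp add: bij_betw_def)
  then show ?thesis
    by (auto simp: unlayer_def layer_def vec_eq_iff split: prod.split)
qed

lemma layer_eqI:
  assumes "\<And>l i j. l < NL \<Longrightarrow> i < m l \<Longrightarrow> j < n l \<Longrightarrow> layer crd l v i j = layer crd l w i j"
  shows "v = w"
proof -
  have "unlayer (\<lambda>l. layer crd l v) = unlayer (\<lambda>l. layer crd l w)"
    using assms crd_bounds by (auto simp: unlayer_def vec_eq_iff split: prod.split)
  then show ?thesis by (simp add: unlayer_layer)
qed

lemma layer_add: "layer crd l (v + w) = (\<lambda>i j. layer crd l v i j + layer crd l w i j)"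
  and layer_scale: "layer crd l (c *\<^sub>R v) = (\<lambda>i j. c * layer crd l v i j)"
  by (simp_all add: layer_def)

lemma inner_layers:
  "v \<bullet> w = (\<Sum>l<NL. \<Sum>i<m l. \<Sum>j<n l. layer crd l v i j * layer crd l w i j)"
proof -
  have inj: "inj crd" using crd by (simp add: bij_betw_def)
  have set: "{(l, i, j). l < NL \<and> i < m l \<and> j < n l} = (SIGMA l:{..<NL}. SIGMA i:{..<m l}. {..<n l})"
    by auto
  have "v \<bullet> w = (\<Sum>k\<in>UNIV. (\<lambda>(l, i, j). layer crd l v i j * layer crd l w i j) (crd k))"
    using inj by (auto simp: inner_vec_def layer_def intro!: sum.cong split: prod.split)
  also have "\<dots> = (\<Sum>(l, i, j)\<in>{(l, i, j). l < NL \<and> i < m l \<and> j < n l}. layer crd l v i j * layer crd l w i j)"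
    by (rule sum.reindex_bij_betw[OF crd])
  also have "\<dots> = (\<Sum>l<NL. \<Sum>i<m l. \<Sum>j<n l. layer crd l v i j * layer crd l w i j)"
    unfolding set by (simp add: sum.Sigma)
  finally show ?thesis .
qed

lemma norm_sq_layers: "(norm v)\<^sup>2 = (\<Sum>l<NL. frob2 (m l) (n l) (layer crd l v))"
  unfolding power2_norm_eq_inner inner_layers frob2_def by (simp add: power2_eq_square)

lemma layer_layer_proj:
  assumes "l < NL" "i < m l" "j < n l"
  shows "layer crd l (layer_proj P Q v) i j =
    (if m l \<le> n l then col_proj (m l) (r l) (P l) (\<lambda>i. layer crd l v i j) i
     else col_proj (n l) (r l) (Q l) (layer crd l v i) j)"
  unfolding layer_proj_def by (rule layer_unlayer[OF assms])

lemma orth_proj_layer_proj: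
  assumes P: "\<And>l. l < NL \<Longrightarrow> m l \<le> n l \<Longrightarrow> orthonormal_cols (m l) (r l) (P l) \<or> P l = (\<lambda>i j. 0)"
    and Q: "\<And>l. l < NL \<Longrightarrow> n l < m l \<Longrightarrow> orthonormal_cols (n l) (r l) (Q l) \<or> Q l = (\<lambda>i j. 0)"
  shows "orth_proj (layer_proj P Q)"
  unfolding orth_proj_def
proof (intro conjI allI)
  show "linear (layer_proj P Q)"
    by (intro linearI layer_eqI)
       (simp_all add: layer_layer_proj layer_add layer_scale col_proj_add col_proj_scale)
  show "layer_proj P Q (layer_proj P Q v) = layer_proj P Q v" for v
  proof (rule layer_eqI)
    fix l i j assume l: "l < NL" and ij: "i < m l" "j < n l"
    show "layer crd l (layer_proj P Q (layer_proj P Q v)) i j = layer crd l (layer_proj P Q v) i j"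
    proof (cases "m l \<le> n l")
      case True
      then have "layer crd l (layer_proj P Q (layer_proj P Q v)) i j
          = col_proj (m l) (r l) (P l) (col_proj (m l) (r l) (P l) (\<lambda>i. layer crd l v i j)) i"
        using l ij by (auto simp: layer_layer_proj intro!: col_proj_cong)
      then show ?thesis using True l ij P by (simp add: col_proj_idem layer_layer_proj)
    next
      case False
      then have "layer crd l (layer_proj P Q (layer_proj P Q v)) i j
          = col_proj (n l) (r l) (Q l) (col_proj (n l) (r l) (Q l) (layer crd l v i)) j"
        using l ij by (auto simp: layer_layer_proj intro!: col_proj_cong)
      then show ?thesis using False l ij Q by (simp add: col_proj_idem layer_layer_proj)
    qed
  qed
  show "layer_proj P Q v \<bullet> w = v \<bullet> layer_proj P Q w" for v w
    unfolding inner_layers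
  proof (rule sum.cong[OF refl])
    fix l assume "l \<in> {..<NL}"
    then have l: "l < NL" by simp
    show "(\<Sum>i<m l. \<Sum>j<n l. layer crd l (layer_proj P Q v) i j * layer crd l w i j)
        = (\<Sum>i<m l. \<Sum>j<n l. layer crd l v i j * layer crd l (layer_proj P Q w) i j)"
    proof (cases "m l \<le> n l")
      case True
      \<comment> \<open>The sums are exchanged so that the row index, on which the projection acts,
        is innermost.\<close>
      show ?thesis
        by (subst (1 2) sum.swap) (simp add: layer_layer_proj l True col_proj_self_adjoint)
    next
      case False
      then show ?thesis by (simp add: layer_layer_proj l col_proj_self_adjoint)
    qed
  qed
qed

lemma ratio_le: "l < NL \<Longrightarrow> ratio \<le> real (r l) / real (min (m l) (n l))"
  unfolding ratio_def by (intro Min_le) auto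

lemma ratio_bounds: "0 < ratio" "ratio \<le> 1"
proof -
  have "ratio \<in> (\<lambda>l. real (r l) / real (min (m l) (n l))) ` {..<NL}"
    unfolding ratio_def using NL_pos by (intro Min_in) auto
  then obtain l where "l < NL" "ratio = real (r l) / real (min (m l) (n l))" by auto
  with rank[of l] show "0 < ratio" "ratio \<le> 1"
    by (simp_all add: divide_le_eq_1 del: of_nat_min)
qed

text \<open>Each layer keeps at least its own rank fraction of the energy, hence at least the
  smallest one. These estimates add up over the layers, and Pythagoras converts energy kept into
  energy lost.\<close>

lemma svd_layer_proj_energy:
  assumes "\<And>l. l < NL \<Longrightarrow> svd_trunc (m l) (n l) (r l) (layer crd l g) (P l) (Q l)"
  shows "orth_proj (layer_proj P Q)"
    and "(norm (g - layer_proj P Q g))\<^sup>2 \<le> (1 - ratio) * (norm g)\<^sup>2"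
proof -
  have r: "r l \<le> min (m l) (n l)" if "l < NL" for l using rank[OF that] by simp
  show proj: "orth_proj (layer_proj P Q)"
    by (rule orth_proj_layer_proj) (use svd_trunc_energy[OF assms r] in auto)
  have "ratio * frob2 (m l) (n l) (layer crd l g) \<le> frob2 (m l) (n l) (layer crd l (layer_proj P Q g))"
    if l: "l < NL" for l
  proof -
    let ?p = "min (m l) (n l)" and ?A = "frob2 (m l) (n l) (layer crd l g)"
    have "real (r l) * ?A \<le> real ?p * frob2 (m l) (n l) (layer crd l (layer_proj P Q g))"
    proof (cases "m l \<le> n l")
      case True
      show ?thesis
        using svd_trunc_energy(1)[OF assms r] l True unfolding frob2_def
        by (subst (1 2) sum.swap) (simp add: layer_layer_proj)
    next
      case False
      then show ?thesis
        using svd_trunc_energy(2)[OF assms r] l unfolding frob2_def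
        by (simp add: layer_layer_proj)
    qed
    then have "real (r l) / real ?p * ?A \<le> frob2 (m l) (n l) (layer crd l (layer_proj P Q g))"
      using rank[OF l] by (simp add: divide_simps mult.commute)
    moreover have "ratio * ?A \<le> real (r l) / real ?p * ?A"
      by (intro mult_right_mono ratio_le l) (auto simp: frob2_def intro!: sum_nonneg)
    ultimately show ?thesis by simp
  qed
  then have "ratio * (norm g)\<^sup>2 \<le> (norm (layer_proj P Q g))\<^sup>2"
    unfolding norm_sq_layers sum_distrib_left by (auto intro: sum_mono)
  then show "(norm (g - layer_proj P Q g))\<^sup>2 \<le> (1 - ratio) * (norm g)\<^sup>2"
    using orth_proj_norm_sq[OF proj, of g] by (simp add: algebra_simps)
qed

lemma mmul_tr: "mmul k A (tr C) = (\<lambda>i j. \<Sum>a<k. A i a * C j a)"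
  by (simp add: mmul_def tr_def)

text \<open>Associativity is the point: P' ((P'^T P) M) is (P' P'^T) (P M). The change-of-basis
  factor in the compressed recursion is exactly what projects the lifted old momentum onto the new
  subspace; the tall case is the mirror image.\<close>

lemma lift_mom_update:
  assumes M': "M' = (\<lambda>l. if m l \<le> n l then
                  (\<lambda>i j. (1 - \<beta>) * mmul (r l) (mmul (m l) (tr (P' l)) (P l)) (M l) i j
                         + \<beta> * mmul (m l) (tr (P' l)) (layer crd l g) i j)
                else
                  (\<lambda>i j. (1 - \<beta>) * mmul (n l) (mmul (r l) (M l) (tr (Q l))) (Q' l) i j
                         + \<beta> * mmul (n l) (layer crd l g) (Q' l) i j))"
  shows "lift_mom P' Q' M' = layer_proj P' Q' ((1 - \<beta>) *\<^sub>R lift_mom P Q M + \<beta> *\<^sub>R g)"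
proof (rule layer_eqI)
  fix l i j assume l: "l < NL" and ij: "i < m l" "j < n l"
  show "layer crd l (lift_mom P' Q' M') i j
      = layer crd l (layer_proj P' Q' ((1 - \<beta>) *\<^sub>R lift_mom P Q M + \<beta> *\<^sub>R g)) i j"
  proof (cases "m l \<le> n l")
    case True
    have "mmul (r l) (mmul (m l) (tr (P' l)) (P l)) (M l) a j = (\<Sum>i<m l. P' l i a * mmul (r l) (P l) (M l) i j)" for a
      unfolding mmul_def tr_def sum_distrib_left sum_distrib_right
      by (subst sum.swap) (simp add: mult_ac)
    moreover have "mmul (m l) (tr (P' l)) (layer crd l g) a j = (\<Sum>i<m l. P' l i a * layer crd l g i j)" for a
      by (simp add: mmul_def tr_def)
    ultimately have "layer crd l (lift_mom P' Q' M') i j = (\<Sum>a<r l. P' l i a *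
        ((1 - \<beta>) * (\<Sum>i<m l. P' l i a * mmul (r l) (P l) (M l) i j) + \<beta> * (\<Sum>i<m l. P' l i a * layer crd l g i j)))"
      using True unfolding lift_mom_def
      by (subst layer_unlayer[OF l ij]) (simp add: M' mmul_def[of "r l" "P' l"])
    also have "\<dots> = col_proj (m l) (r l) (P' l) (\<lambda>i. (1 - \<beta>) * mmul (r l) (P l) (M l) i j + \<beta> * layer crd l g i j) i"
      by (simp add: col_proj_def distrib_left sum.distrib sum_distrib_left mult_ac)
    also have "\<dots> = layer crd l (layer_proj P' Q' ((1 - \<beta>) *\<^sub>R lift_mom P Q M + \<beta> *\<^sub>R g)) i j"
      using True l ij
      by (auto simp: layer_layer_proj layer_add layer_scale lift_mom_def layer_unlayer intro!: col_proj_cong)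
    finally show ?thesis .
  next
    case False
    then have "layer crd l (lift_mom P' Q' M') i j = (\<Sum>a<r l. ((1 - \<beta>) *
        (\<Sum>j'<n l. mmul (r l) (M l) (tr (Q l)) i j' * Q' l j' a) + \<beta> * (\<Sum>j'<n l. layer crd l g i j' * Q' l j' a)) * Q' l j a)"
      unfolding lift_mom_def
      by (subst layer_unlayer[OF l ij]) (simp add: M' mmul_tr mmul_def[of "n l" _ "Q' l"])
    also have "\<dots> = col_proj (n l) (r l) (Q' l) (\<lambda>j. (1 - \<beta>) * mmul (r l) (M l) (tr (Q l)) i j + \<beta> * layer crd l g i j) j"
      by (simp add: col_proj_def distrib_left distrib_right sum.distrib sum_distrib_left sum_distrib_right mult_ac)
    also have "\<dots> = layer crd l (layer_proj P' Q' ((1 - \<beta>) *\<^sub>R lift_mom P Q M + \<beta> *\<^sub>R g)) i j"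
      using False l ij
      by (auto simp: layer_layer_proj layer_add layer_scale lift_mom_def layer_unlayer intro!: col_proj_cong)
    finally show ?thesis .
  qed
qed

end

section \<open>Resampling one coordinate of a product space\<close>

text \<open>Overwriting one coordinate by an independent copy preserves the product measure.
  Integrating over that copy first plays the role of conditioning on all other samples.\<close>

lemma resample_distr:
  assumes "prob_space D"
  shows "distr (D \<Otimes>\<^sub>M (\<Pi>\<^sub>M i\<in>UNIV. D)) (\<Pi>\<^sub>M i\<in>UNIV. D) (\<lambda>(v, \<omega>). \<omega> (i := v)) = (\<Pi>\<^sub>M i\<in>UNIV. D)"
  using distr_pair_PiM_eq_PiM[of UNIV "\<lambda>_. D" i] assms by simp

lemma measurable_resample [measurable]:
  "(\<lambda>(v, \<omega>). \<omega> (i := v)) \<in> D \<Otimes>\<^sub>M (\<Pi>\<^sub>M i\<in>UNIV. D) \<rightarrow>\<^sub>M (\<Pi>\<^sub>M i\<in>UNIV. D)"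
  unfolding case_prod_beta by (rule measurable_fun_upd[where J = UNIV]) auto

text \<open>The nonnegative version can be used before integrability is known, and it is what yields
  square integrability of the noise.\<close>

lemma nn_integral_resample:
  fixes h :: "('i \<Rightarrow> 'b) \<Rightarrow> ennreal"
  assumes D: "prob_space D" and [measurable]: "h \<in> borel_measurable (\<Pi>\<^sub>M i\<in>UNIV. D)"
  shows "(\<integral>\<^sup>+\<omega>. h \<omega> \<partial>(\<Pi>\<^sub>M i\<in>UNIV. D)) = (\<integral>\<^sup>+\<omega>. \<integral>\<^sup>+v. h (\<omega> (i := v)) \<partial>D \<partial>(\<Pi>\<^sub>M i\<in>UNIV. D))"
proof -
  interpret D: prob_space D by fact
  interpret P: prob_space "\<Pi>\<^sub>M i\<in>(UNIV::'i set). D" by (intro prob_space_PiM D)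
  interpret pair_sigma_finite D "\<Pi>\<^sub>M i\<in>(UNIV::'i set). D" ..
  have "(\<integral>\<^sup>+\<omega>. h \<omega> \<partial>(\<Pi>\<^sub>M i\<in>UNIV. D))
      = (\<integral>\<^sup>+z. h ((\<lambda>(v, \<omega>). \<omega> (i := v)) z) \<partial>(D \<Otimes>\<^sub>M (\<Pi>\<^sub>M i\<in>UNIV. D)))"
    using nn_integral_distr[OF measurable_resample, of h D i] by (simp add: resample_distr[OF D])
  also have "\<dots> = (\<integral>\<^sup>+\<omega>. \<integral>\<^sup>+v. h (\<omega> (i := v)) \<partial>D \<partial>(\<Pi>\<^sub>M i\<in>UNIV. D))"
    using measurable_compose[OF measurable_resample assms(2), of i]
    by (subst nn_integral_snd[symmetric]) auto
  finally show ?thesis .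
qed

lemma integral_resample:
  fixes h :: "('i \<Rightarrow> 'b) \<Rightarrow> real"
  assumes D: "prob_space D" and h: "integrable (\<Pi>\<^sub>M i\<in>UNIV. D) h"
  shows "(\<integral>\<omega>. h \<omega> \<partial>(\<Pi>\<^sub>M i\<in>UNIV. D)) = (\<integral>\<omega>. \<integral>v. h (\<omega> (i := v)) \<partial>D \<partial>(\<Pi>\<^sub>M i\<in>UNIV. D))"
proof -
  interpret D: prob_space D by fact
  interpret P: prob_space "\<Pi>\<^sub>M i\<in>(UNIV::'i set). D" by (intro prob_space_PiM D)
  interpret pair_sigma_finite D "\<Pi>\<^sub>M i\<in>(UNIV::'i set). D" ..
  have [measurable]: "h \<in> borel_measurable (\<Pi>\<^sub>M i\<in>UNIV. D)" using h by auto
  have "(\<integral>\<omega>. h \<omega> \<partial>(\<Pi>\<^sub>M i\<in>UNIV. D))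
      = (\<integral>z. h ((\<lambda>(v, \<omega>). \<omega> (i := v)) z) \<partial>(D \<Otimes>\<^sub>M (\<Pi>\<^sub>M i\<in>UNIV. D)))"
    using integral_distr[OF measurable_resample, of h D i] by (simp add: resample_distr[OF D])
  also have "\<dots> = (\<integral>(v, \<omega>). h (\<omega> (i := v)) \<partial>(D \<Otimes>\<^sub>M (\<Pi>\<^sub>M i\<in>UNIV. D)))"
    by (rule Bochner_Integration.integral_cong) auto
  also have "\<dots> = (\<integral>\<omega>. \<integral>v. h (\<omega> (i := v)) \<partial>D \<partial>(\<Pi>\<^sub>M i\<in>UNIV. D))"
  proof (rule integral_snd[symmetric])
    have "integrable (D \<Otimes>\<^sub>M (\<Pi>\<^sub>M i\<in>UNIV. D)) (\<lambda>z. h ((\<lambda>(v, \<omega>). \<omega> (i := v)) z))"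
      by (rule integrable_distr[OF measurable_resample]) (simp add: resample_distr[OF D] h)
    then show "integrable (D \<Otimes>\<^sub>M (\<Pi>\<^sub>M i\<in>UNIV. D)) (\<lambda>(v, \<omega>). h (\<omega> (i := v)))"
      by (rule Bochner_Integration.integrable_cong[THEN iffD1, rotated -1]) auto
  qed
  finally show ?thesis .
qed

section \<open>Square integrable random vectors\<close>

definition square_integrable :: "'c measure \<Rightarrow> ('c \<Rightarrow> 'a::euclidean_space) \<Rightarrow> bool" where
  "square_integrable M Y \<longleftrightarrow> Y \<in> borel_measurable M \<and> integrable M (\<lambda>\<omega>. (norm (Y \<omega>))\<^sup>2)"

lemma square_integrableD:
  assumes "square_integrable M Y"
  shows "Y \<in> borel_measurable M" "integrable M (\<lambda>\<omega>. (norm (Y \<omega>))\<^sup>2)"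
  using assms by (auto simp: square_integrable_def)

lemma square_integrable_dominated:
  assumes "square_integrable M Y" "Z \<in> borel_measurable M" "\<And>\<omega>. norm (Z \<omega>) \<le> C * norm (Y \<omega>)"
  shows "square_integrable M Z"
proof -
  have le: "(norm (Z \<omega>))\<^sup>2 \<le> C\<^sup>2 * (norm (Y \<omega>))\<^sup>2" for \<omega>
    using power_mono[OF assms(3)[of \<omega>] norm_ge_zero, of 2] by (simp add: power_mult_distrib)
  have "integrable M (\<lambda>\<omega>. (norm (Z \<omega>))\<^sup>2)"
    by (rule Bochner_Integration.integrable_bound[of M "\<lambda>\<omega>. C\<^sup>2 * (norm (Y \<omega>))\<^sup>2"])
       (use le assms in \<open>auto simp: square_integrable_def\<close>)
  then show ?thesis using assms(2) by (simp add: square_integrable_def)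
qed

lemma square_integrable_add:
  assumes "square_integrable M Y" "square_integrable M Z"
  shows "square_integrable M (\<lambda>\<omega>. Y \<omega> + Z \<omega>)"
proof -
  have [measurable]: "Y \<in> borel_measurable M" "Z \<in> borel_measurable M"
    using assms by (auto dest: square_integrableD)
  have le: "(norm (Y \<omega> + Z \<omega>))\<^sup>2 \<le> 2 * (norm (Y \<omega>))\<^sup>2 + 2 * (norm (Z \<omega>))\<^sup>2" for \<omega>
    using norm_add_sq_le[of 1 "Y \<omega>" "Z \<omega>"] by simp
  have "integrable M (\<lambda>\<omega>. (norm (Y \<omega> + Z \<omega>))\<^sup>2)"
    by (rule Bochner_Integration.integrable_bound[of M "\<lambda>\<omega>. 2 * (norm (Y \<omega>))\<^sup>2 + 2 * (norm (Z \<omega>))\<^sup>2"])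
       (use le assms in \<open>auto simp: square_integrable_def\<close>)
  then show ?thesis by (simp add: square_integrable_def)
qed

lemma square_integrable_scaleR:
  assumes "square_integrable M Y"
  shows "square_integrable M (\<lambda>\<omega>. c *\<^sub>R Y \<omega>)"
  by (rule square_integrable_dominated[OF assms, of _ "\<bar>c\<bar>"])
     (use assms in \<open>auto dest: square_integrableD\<close>)

lemma square_integrable_diff:
  assumes "square_integrable M Y" "square_integrable M Z"
  shows "square_integrable M (\<lambda>\<omega>. Y \<omega> - Z \<omega>)"
  using square_integrable_add[OF assms(1) square_integrable_scaleR[OF assms(2), of "- 1"]] by simp

lemma square_integrable_const: "finite_measure M \<Longrightarrow> square_integrable M (\<lambda>\<omega>. c)"
  by (simp add: square_integrable_def finite_measure.integrable_const)

lemma square_integrable_sum: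
  assumes "finite_measure M" "\<And>i. i \<in> I \<Longrightarrow> square_integrable M (Y i)"
  shows "square_integrable M (\<lambda>\<omega>. \<Sum>i\<in>I. Y i \<omega>)"
  using assms(2)
  by (induction I rule: infinite_finite_induct)
     (auto intro: square_integrable_const[OF assms(1)] square_integrable_add)

lemma integrable_inner_square_integrable:
  assumes "square_integrable M Y" "square_integrable M Z"
  shows "integrable M (\<lambda>\<omega>. Y \<omega> \<bullet> Z \<omega>)"
proof -
  have [measurable]: "Y \<in> borel_measurable M" "Z \<in> borel_measurable M"
    using assms by (auto dest: square_integrableD)
  have le: "\<bar>Y \<omega> \<bullet> Z \<omega>\<bar> \<le> (norm (Y \<omega>))\<^sup>2 + (norm (Z \<omega>))\<^sup>2" for \<omega>
  proof -
    have "\<bar>Y \<omega> \<bullet> Z \<omega>\<bar> \<le> norm (Y \<omega>) * norm (Z \<omega>)" by (rule Cauchy_Schwarz_ineq2)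
    also have "\<dots> \<le> (norm (Y \<omega>))\<^sup>2 + (norm (Z \<omega>))\<^sup>2"
      using sum_squares_bound[of "norm (Y \<omega>)" "norm (Z \<omega>)"]
        mult_nonneg_nonneg[OF norm_ge_zero norm_ge_zero, of "Y \<omega>" "Z \<omega>"] by linarith
    finally show ?thesis .
  qed
  show ?thesis
    by (rule Bochner_Integration.integrable_bound[of M "\<lambda>\<omega>. (norm (Y \<omega>))\<^sup>2 + (norm (Z \<omega>))\<^sup>2"])
       (use le assms in \<open>auto simp: square_integrable_def\<close>)
qed


lemma lipschitz_borel_measurable:
  fixes G :: "'a::euclidean_space \<Rightarrow> 'b::euclidean_space"
  assumes "\<And>x y. norm (G x - G y) \<le> L * norm (x - y)"
  shows "G \<in> borel_measurable borel"
proof (rule borel_measurable_continuous_onI)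
  \<comment> \<open>\<open>lipschitz_on\<close> demands a nonnegative constant, while the sign of
    \<open>L\<close> is not fixed here.\<close>
  have "(max L 0)-lipschitz_on UNIV G"
  proof (rule lipschitz_onI)
    fix x y :: 'a
    have "L * norm (x - y) \<le> max L 0 * norm (x - y)" by (intro mult_right_mono) auto
    then show "dist (G x) (G y) \<le> max L 0 * dist x y"
      using assms[of x y] by (simp add: dist_norm)
  qed simp
  then show "continuous_on UNIV G" by (rule lipschitz_on_continuous_on)
qed

text \<open>The difference from the constant \<open>G 0\<close> is dominated by \<open>L\<close>
  times the norm of \<open>Y\<close>, and constants are square integrable on a finite
  measure.\<close>

lemma lipschitz_square_integrable:
  fixes G :: "'a::euclidean_space \<Rightarrow> 'b::euclidean_space"
  assumes M: "finite_measure M" and Y: "square_integrable M Y"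
    and lip: "\<And>x y. norm (G x - G y) \<le> L * norm (x - y)"
  shows "square_integrable M (\<lambda>\<omega>. G (Y \<omega>))"
proof -
  have "square_integrable M (\<lambda>\<omega>. G (Y \<omega>) - G 0)"
    using measurable_compose[OF square_integrableD(1)[OF Y] lipschitz_borel_measurable[OF lip]] lip[of _ 0]
    by (intro square_integrable_dominated[OF Y, of _ L]) auto
  from square_integrable_add[OF this square_integrable_const[OF M, of "G 0"]] show ?thesis by simp
qed

section \<open>GaLore as projected momentum descent\<close>

locale galore_process = layered NL m n r crd
  for NL :: nat and m n r :: "nat \<Rightarrow> nat" and crd :: "'d::finite \<Rightarrow> nat \<times> nat \<times> nat" +
  fixes D :: "'b measure" and gradF :: "real^'d \<Rightarrow> 'b \<Rightarrow> real^'d"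
    and f :: "real^'d \<Rightarrow> real" and gradf :: "real^'d \<Rightarrow> real^'d"
    and L \<sigma>2 :: real
    and sel :: "nat \<Rightarrow> nat \<Rightarrow> rmat \<Rightarrow> rmat \<times> rmat"
    and x0 :: "real^'d" and \<beta> \<eta> :: real and \<tau> B :: nat
  assumes D: "prob_space D"
    and f_deriv: "\<And>x. (f has_derivative (\<lambda>h. gradf x \<bullet> h)) (at x)"
    and f_bdd: "bdd_below (range f)"
    and lip: "\<And>x y. norm (gradf x - gradf y) \<le> L * norm (x - y)"
    and unbiased: "\<And>x. integrable D (gradF x)" "\<And>x. (\<integral>\<xi>. gradF x \<xi> \<partial>D) = gradf x"
    and variance: "\<And>x. (\<integral>\<^sup>+\<xi>. ennreal ((norm (gradF x \<xi> - gradf x))\<^sup>2) \<partial>D) \<le> ennreal \<sigma>2"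
    and \<sigma>2_nonneg: "0 \<le> \<sigma>2"
    and gradF_meas: "(\<lambda>(x, \<xi>). gradF x \<xi>) \<in> borel_measurable (borel \<Otimes>\<^sub>M D)"
    and sel_meas: "\<And>t l i j. (\<lambda>g::real^'d. fst (sel t l (layer crd l g)) i j) \<in> borel_measurable borel"
      "\<And>t l i j. (\<lambda>g::real^'d. snd (sel t l (layer crd l g)) i j) \<in> borel_measurable borel"
    and sel_svd: "\<And>t l G. l < NL \<Longrightarrow>
        svd_trunc (m l) (n l) (r l) G (fst (sel t l G)) (snd (sel t l G))"
    and B: "1 \<le> B"
    and \<beta>: "0 < \<beta>" "\<beta> \<le> 1" and \<eta>: "0 < \<eta>" and \<tau>_pos: "0 < \<tau>"
    and \<tau>_ge: "64 \<le> 3 * \<beta> * ratio * real \<tau>"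
    and \<eta>1: "4 * L * \<eta> \<le> 1"
    and \<eta>2: "80 * L\<^sup>2 * \<eta>\<^sup>2 \<le> 3 * ratio * \<beta>\<^sup>2"
    and \<eta>3: "40 * (real \<tau>)\<^sup>2 * L\<^sup>2 * \<eta>\<^sup>2 \<le> ratio"
    and \<eta>4: "32 * real \<tau> * L\<^sup>2 * \<eta>\<^sup>2 \<le> 3 * \<beta>"
begin

abbreviation \<Omega> :: "(nat \<times> nat \<Rightarrow> 'b) measure" where
  "\<Omega> \<equiv> \<Pi>\<^sub>M ij\<in>UNIV. D"

abbreviation state :: "(nat \<times> nat \<Rightarrow> 'b) \<Rightarrow> nat \<Rightarrow> 'd gstate" where
  "state \<omega> t \<equiv> galore crd m n r gradF sel x0 \<beta> \<eta> \<tau> B \<omega> t"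

definition X :: "nat \<Rightarrow> (nat \<times> nat \<Rightarrow> 'b) \<Rightarrow> real^'d" where "X t \<omega> = fst (state \<omega> t)"
definition P :: "nat \<Rightarrow> (nat \<times> nat \<Rightarrow> 'b) \<Rightarrow> nat \<Rightarrow> rmat" where "P t \<omega> = fst (snd (state \<omega> t))"
definition Q :: "nat \<Rightarrow> (nat \<times> nat \<Rightarrow> 'b) \<Rightarrow> nat \<Rightarrow> rmat" where "Q t \<omega> = fst (snd (snd (state \<omega> t)))"
definition M :: "nat \<Rightarrow> (nat \<times> nat \<Rightarrow> 'b) \<Rightarrow> nat \<Rightarrow> rmat" where "M t \<omega> = snd (snd (snd (state \<omega> t)))"

definition grad :: "nat \<Rightarrow> (nat \<times> nat \<Rightarrow> 'b) \<Rightarrow> real^'d" where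
  "grad t \<omega> = (if t mod \<tau> = 0 then (1 / real B) *\<^sub>R (\<Sum>b<B. gradF (X t \<omega>) (\<omega> (t, b)))
     else gradF (X t \<omega>) (\<omega> (t, 0)))"

definition mom :: "nat \<Rightarrow> (nat \<times> nat \<Rightarrow> 'b) \<Rightarrow> real^'d" where
  "mom t \<omega> = lift_mom (P t \<omega>) (Q t \<omega>) (M t \<omega>)"

definition proj :: "nat \<Rightarrow> (nat \<times> nat \<Rightarrow> 'b) \<Rightarrow> real^'d \<Rightarrow> real^'d" where
  "proj t \<omega> = layer_proj (P t \<omega>) (Q t \<omega>)"

lemma state_eq: "state \<omega> t = (X t \<omega>, P t \<omega>, Q t \<omega>, M t \<omega>)"
  by (simp add: X_def P_def Q_def M_def)

lemma state_0: "X 0 \<omega> = x0" "P 0 \<omega> = (\<lambda>l i j. 0)" "Q 0 \<omega> = (\<lambda>l i j. 0)" "M 0 \<omega> = (\<lambda>l i j. 0)"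
  by (simp_all add: X_def P_def Q_def M_def)

lemma P_Suc: "P (Suc t) \<omega> = (\<lambda>l. if t mod \<tau> = 0 then fst (sel t l (layer crd l (grad t \<omega>))) else P t \<omega> l)"
  and Q_Suc: "Q (Suc t) \<omega> = (\<lambda>l. if t mod \<tau> = 0 then snd (sel t l (layer crd l (grad t \<omega>))) else Q t \<omega> l)"
  by (simp_all add: P_def[of "Suc t"] Q_def[of "Suc t"] state_eq Let_def grad_def)

lemma M_Suc: "M (Suc t) \<omega> = (\<lambda>l. if m l \<le> n l then
    (\<lambda>i j. (1 - \<beta>) * mmul (r l) (mmul (m l) (tr (P (Suc t) \<omega> l)) (P t \<omega> l)) (M t \<omega> l) i j
           + \<beta> * mmul (m l) (tr (P (Suc t) \<omega> l)) (layer crd l (grad t \<omega>)) i j)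
    else
    (\<lambda>i j. (1 - \<beta>) * mmul (n l) (mmul (r l) (M t \<omega> l) (tr (Q t \<omega> l))) (Q (Suc t) \<omega> l) i j
           + \<beta> * mmul (n l) (layer crd l (grad t \<omega>)) (Q (Suc t) \<omega> l) i j))"
  by (simp add: P_Suc Q_Suc M_def[of "Suc t"] state_eq Let_def grad_def cong: if_cong)

lemma X_Suc: "X (Suc t) \<omega> = X t \<omega> - \<eta> *\<^sub>R mom (Suc t) \<omega>"
  unfolding mom_def lift_mom_def unlayer_def M_Suc
  by (auto simp: vec_eq_iff P_Suc Q_Suc X_def[of "Suc t"] state_eq Let_def grad_def split: prod.split cong: if_cong)

lemma mom_Suc: "mom (Suc t) \<omega> = proj (Suc t) \<omega> ((1 - \<beta>) *\<^sub>R mom t \<omega> + \<beta> *\<^sub>R grad t \<omega>)"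
  unfolding mom_def proj_def by (rule lift_mom_update[OF M_Suc])

lemma mom_0: "mom 0 \<omega> = 0"
  by (auto simp: mom_def lift_mom_def unlayer_def state_0 mmul_def vec_eq_iff split: prod.split)

lemma proj_lazy: "t mod \<tau> \<noteq> 0 \<Longrightarrow> proj (Suc t) \<omega> = proj t \<omega>"
  by (simp add: proj_def P_Suc Q_Suc)

lemma proj_refresh:
  assumes "t mod \<tau> = 0"
  shows "orth_proj (proj (Suc t) \<omega>)"
    "(norm (grad t \<omega> - proj (Suc t) \<omega> (grad t \<omega>)))\<^sup>2 \<le> (1 - ratio) * (norm (grad t \<omega>))\<^sup>2"
proof -
  have "svd_trunc (m l) (n l) (r l) (layer crd l (grad t \<omega>)) (P (Suc t) \<omega> l) (Q (Suc t) \<omega> l)"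
    if "l < NL" for l
    using assms that by (simp add: P_Suc Q_Suc sel_svd)
  from svd_layer_proj_energy[OF this] show "orth_proj (proj (Suc t) \<omega>)"
    "(norm (grad t \<omega> - proj (Suc t) \<omega> (grad t \<omega>)))\<^sup>2 \<le> (1 - ratio) * (norm (grad t \<omega>))\<^sup>2"
    by (simp_all add: proj_def)
qed

lemma orth_proj_proj: "orth_proj (proj t \<omega>)"
proof (induction t)
  case 0
  \<comment> \<open>Before the first refresh both factors are zero, and the zero map counts as an
    orthogonal projection.\<close>
  show ?case unfolding proj_def by (rule orth_proj_layer_proj) (auto simp: state_0)
next
  case (Suc t)
  then show ?case by (cases "t mod \<tau> = 0") (simp_all add: proj_refresh proj_lazy)
qed

lemma projected_momentum_path:
  "projected_momentum f gradf L ratio \<beta> \<eta> \<tau> (\<lambda>t. X t \<omega>) (\<lambda>t. mom t \<omega>) (\<lambda>t. grad t \<omega>) (\<lambda>t. proj t \<omega>)"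
  by unfold_locales
     (use f_deriv lip ratio_bounds \<beta> \<eta> \<tau>_pos \<tau>_ge \<eta>1 \<eta>2 \<eta>3 \<eta>4 in
      \<open>simp_all add: mom_0 mom_Suc[symmetric] X_Suc[symmetric] orth_proj_proj proj_lazy proj_refresh\<close>)

text \<open>Noise and bias are stated again with the sample path as an explicit argument, so that
  they are random variables; \<open>path_inequality\<close> identifies them with the pathwise
  notions.\<close>

definition noise :: "nat \<Rightarrow> (nat \<times> nat \<Rightarrow> 'b) \<Rightarrow> real^'d" where
  "noise t \<omega> = grad t \<omega> - gradf (X t \<omega>)"

definition bias :: "nat \<Rightarrow> (nat \<times> nat \<Rightarrow> 'b) \<Rightarrow> real^'d" where
  "bias t \<omega> = mom t \<omega> - (if t mod \<tau> = 0 then gradf (X t \<omega>) else proj t \<omega> (gradf (X t \<omega>)))"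

definition sample_noise :: "nat \<times> nat \<Rightarrow> (nat \<times> nat \<Rightarrow> 'b) \<Rightarrow> real^'d" where
  "sample_noise i \<omega> = gradF (X (fst i) \<omega>) (\<omega> i) - gradf (X (fst i) \<omega>)"

lemma path_inequality:
  assumes "1 \<le> K"
  shows "7 / 64 * \<eta> * ratio * (\<Sum>t<K * \<tau>. (norm (gradf (X t \<omega>)))\<^sup>2)
    \<le> f x0 - (INF x. f x) + \<eta> / 2 * (16 * real \<tau> / ratio * (\<Sum>k<K. (norm (noise (k * \<tau>) \<omega>))\<^sup>2)
        + 1 / \<beta> * (\<Sum>t<K * \<tau>. 2 * \<beta> * (1 - \<beta>) * (bias t \<omega> \<bullet> noise t \<omega>) + \<beta>\<^sup>2 * (norm (noise t \<omega>))\<^sup>2))"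
proof -
  note pm = projected_momentum_path[of \<omega>]
  have "(INF x. f x) \<le> f (X (K * \<tau>) \<omega>)" by (rule cINF_lower[OF f_bdd]) simp
  moreover have "projected_momentum.noise gradf (\<lambda>t. X t \<omega>) (\<lambda>t. grad t \<omega>) t = noise t \<omega>" for t
    by (simp add: projected_momentum.noise_def[OF pm] noise_def)
  moreover have "projected_momentum.bias gradf \<tau> (\<lambda>t. X t \<omega>) (\<lambda>t. mom t \<omega>) (\<lambda>t. proj t \<omega>) t = bias t \<omega>" for t
    by (simp add: projected_momentum.bias_def[OF pm] bias_def)
  ultimately show ?thesis
    using projected_momentum.path_bound[OF pm assms]
    by (simp add: projected_momentum.noise_term_def[OF pm] state_0)
qed

text \<open>Adaptedness without a filtration: agreement of the samples drawn before step
  \<open>t\<close> determines the state. Invariance under redrawing a later sample is how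
  independence of the past is used below.\<close>

lemma state_cong:
  "(\<And>s b. s < t \<Longrightarrow> \<omega> (s, b) = \<omega>' (s, b)) \<Longrightarrow> state \<omega> t = state \<omega>' t"
proof (induction t)
  case (Suc t)
  have st: "state \<omega> t = state \<omega>' t" by (rule Suc.IH) (simp add: Suc.prems)
  have \<omega>: "\<omega> (t, b) = \<omega>' (t, b)" for b by (simp add: Suc.prems)
  show ?case unfolding galore.simps st \<omega> by (rule refl)
qed simp

lemma state_resample: "t \<le> fst i \<Longrightarrow> state (\<omega> (i := v)) t = state \<omega> t"
  by (rule state_cong) auto

lemma X_resample [simp]: "t \<le> fst i \<Longrightarrow> X t (\<omega> (i := v)) = X t \<omega>"
  and bias_resample: "t \<le> fst i \<Longrightarrow> bias t (\<omega> (i := v)) = bias t \<omega>"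
  by (simp_all add: X_def bias_def mom_def proj_def P_def Q_def M_def state_resample)

lemma sample_noise_resample:
  "fst i \<le> fst j \<Longrightarrow> i \<noteq> j \<Longrightarrow> sample_noise i (\<omega> (j := v)) = sample_noise i \<omega>"
  by (simp add: sample_noise_def)

end

section \<open>Measurability and expectations\<close>

context layered
begin

lemma measurable_unlayer:
  assumes "\<And>l i j. (\<lambda>\<omega>. A \<omega> l i j) \<in> borel_measurable N"
  shows "(\<lambda>\<omega>. unlayer (A \<omega>)) \<in> borel_measurable N"
proof (rule borel_measurable_euclidean_space[THEN iffD2], rule)
  fix e :: "real^'d" assume "e \<in> Basis"
  then obtain k where e: "e = axis k 1" by (auto simp: Basis_vec_def)
  obtain l i j where "crd k = (l, i, j)" by (cases "crd k")
  then show "(\<lambda>\<omega>. unlayer (A \<omega>) \<bullet> e) \<in> borel_measurable N"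
    using assms[of l i j] by (simp add: e inner_axis unlayer_def)
qed

lemma measurable_layer:
  assumes "v \<in> borel_measurable N"
  shows "(\<lambda>\<omega>. layer crd l (v \<omega>) i j) \<in> borel_measurable N"
  unfolding layer_def by (rule measurable_compose[OF assms borel_measurable_nth])

lemma measurable_mmul:
  assumes "\<And>i j. (\<lambda>\<omega>. A \<omega> i j) \<in> borel_measurable N" "\<And>i j. (\<lambda>\<omega>. C \<omega> i j) \<in> borel_measurable N"
  shows "(\<lambda>\<omega>. mmul k (A \<omega>) (C \<omega>) i j) \<in> borel_measurable N"
  unfolding mmul_def by (intro borel_measurable_sum borel_measurable_times assms)

lemma measurable_tr:
  assumes "\<And>i j. (\<lambda>\<omega>. A \<omega> i j) \<in> borel_measurable N"
  shows "(\<lambda>\<omega>. tr (A \<omega>) i j) \<in> borel_measurable N"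
  unfolding tr_def by (rule assms)

lemma measurable_layer_proj:
  assumes "\<And>l i j. (\<lambda>\<omega>. P \<omega> l i j) \<in> borel_measurable N" "\<And>l i j. (\<lambda>\<omega>. Q \<omega> l i j) \<in> borel_measurable N"
    and "v \<in> borel_measurable N"
  shows "(\<lambda>\<omega>. layer_proj (P \<omega>) (Q \<omega>) (v \<omega>)) \<in> borel_measurable N"
  unfolding layer_proj_def
proof (rule measurable_unlayer)
  fix l i j
  show "(\<lambda>\<omega>. if m l \<le> n l then col_proj (m l) (r l) (P \<omega> l) (\<lambda>i. layer crd l (v \<omega>) i j) i
      else col_proj (n l) (r l) (Q \<omega> l) (layer crd l (v \<omega>) i) j) \<in> borel_measurable N"
    unfolding col_proj_def
    by (cases "m l \<le> n l")
       (simp_all, intro borel_measurable_sum borel_measurable_times assms measurable_layer,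
         intro borel_measurable_sum borel_measurable_times assms measurable_layer)
qed

lemma measurable_lift_mom:
  assumes "\<And>l i j. (\<lambda>\<omega>. P \<omega> l i j) \<in> borel_measurable N" "\<And>l i j. (\<lambda>\<omega>. Q \<omega> l i j) \<in> borel_measurable N"
    and "\<And>l i j. (\<lambda>\<omega>. M \<omega> l i j) \<in> borel_measurable N"
  shows "(\<lambda>\<omega>. lift_mom (P \<omega>) (Q \<omega>) (M \<omega>)) \<in> borel_measurable N"
  unfolding lift_mom_def
proof (rule measurable_unlayer)
  fix l i j
  show "(\<lambda>\<omega>. (if m l \<le> n l then mmul (r l) (P \<omega> l) (M \<omega> l) else mmul (r l) (M \<omega> l) (tr (Q \<omega> l))) i j)
      \<in> borel_measurable N"
    by (cases "m l \<le> n l") (simp_all add: assms measurable_mmul measurable_tr)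
qed

end

section \<open>Moments of the noise and of the iterates\<close>

context galore_process
begin

sublocale D: prob_space D by (rule D)

sublocale \<Omega>: prob_space \<Omega> by (intro prob_space_PiM D)

lemma measurable_gradF:
  assumes [measurable]: "Y \<in> borel_measurable \<Omega>"
  shows "(\<lambda>\<omega>. gradF (Y \<omega>) (\<omega> i)) \<in> borel_measurable \<Omega>"
proof -
  have "(\<lambda>\<omega>. (Y \<omega>, \<omega> i)) \<in> \<Omega> \<rightarrow>\<^sub>M borel \<Otimes>\<^sub>M D"
    by measurable
  from measurable_compose[OF this gradF_meas] show ?thesis by simp
qed

lemma measurable_gradf: "gradf \<in> borel_measurable borel"
  by (rule lipschitz_borel_measurable[OF lip])

lemma measurable_grad:
  assumes "X t \<in> borel_measurable \<Omega>"
  shows "grad t \<in> borel_measurable \<Omega>"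
  unfolding grad_def[abs_def]
  by (cases "t mod \<tau> = 0")
     (simp_all add: borel_measurable_scaleR borel_measurable_sum measurable_gradF assms)

text \<open>All state components go into one induction because each update uses the others. At a
  refresh the SVD choice is measurable by composing \<open>sel_meas\<close> with the sampled
  gradient.\<close>

lemma measurable_state:
  "X t \<in> borel_measurable \<Omega> \<and> (\<forall>l i j. (\<lambda>\<omega>. P t \<omega> l i j) \<in> borel_measurable \<Omega>
    \<and> (\<lambda>\<omega>. Q t \<omega> l i j) \<in> borel_measurable \<Omega> \<and> (\<lambda>\<omega>. M t \<omega> l i j) \<in> borel_measurable \<Omega>)"
proof (induction t)
  case 0
  have "X 0 = (\<lambda>\<omega>. x0)" by (simp add: fun_eq_iff state_0)
  then show ?case by (simp add: state_0)
next
  case (Suc t)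
  note g = measurable_grad[OF Suc.IH[THEN conjunct1]]
  have P: "(\<lambda>\<omega>. P (Suc t) \<omega> l i j) \<in> borel_measurable \<Omega>"
    and Q: "(\<lambda>\<omega>. Q (Suc t) \<omega> l i j) \<in> borel_measurable \<Omega>" for l i j
    using Suc.IH measurable_compose[OF g sel_meas(1)] measurable_compose[OF g sel_meas(2)]
    by (cases "t mod \<tau> = 0"; simp add: P_Suc Q_Suc)+
  have M: "(\<lambda>\<omega>. M (Suc t) \<omega> l i j) \<in> borel_measurable \<Omega>" for l i j
    unfolding M_Suc using Suc.IH P Q
    by (cases "m l \<le> n l")
       (simp_all add: measurable_mmul measurable_tr measurable_layer[OF g] borel_measurable_add borel_measurable_times)
  have "(\<lambda>\<omega>. X t \<omega> - \<eta> *\<^sub>R mom (Suc t) \<omega>) \<in> borel_measurable \<Omega>"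
    unfolding mom_def
    by (intro borel_measurable_diff borel_measurable_scaleR borel_measurable_const measurable_lift_mom
        P Q M Suc.IH[THEN conjunct1])
  then have "X (Suc t) \<in> borel_measurable \<Omega>" by (simp add: X_Suc[symmetric])
  then show ?case using P Q M by simp
qed

lemma X_meas: "X t \<in> borel_measurable \<Omega>"
  and mom_meas: "mom t \<in> borel_measurable \<Omega>"
  and proj_meas: "v \<in> borel_measurable \<Omega> \<Longrightarrow> (\<lambda>\<omega>. proj t \<omega> (v \<omega>)) \<in> borel_measurable \<Omega>"
proof -
  show "X t \<in> borel_measurable \<Omega>" using measurable_state by blast
  show "mom t \<in> borel_measurable \<Omega>"
    unfolding mom_def[abs_def] by (rule measurable_lift_mom) (use measurable_state[of t] in simp_all)
  show "(\<lambda>\<omega>. proj t \<omega> (v \<omega>)) \<in> borel_measurable \<Omega>" if "v \<in> borel_measurable \<Omega>"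
    unfolding proj_def by (rule measurable_layer_proj[OF _ _ that]) (use measurable_state[of t] in simp_all)
qed

lemma sample_noise_meas: "sample_noise i \<in> borel_measurable \<Omega>"
  unfolding sample_noise_def[abs_def]
  by (intro borel_measurable_diff measurable_gradF X_meas measurable_compose[OF X_meas measurable_gradf])

lemma sample_noise_update:
  "sample_noise i (\<omega> (i := v)) = gradF (X (fst i) \<omega>) v - gradf (X (fst i) \<omega>)"
  by (simp add: sample_noise_def)

text \<open>Redrawing sample \<open>i\<close> leaves the iterate at which it is evaluated unchanged,
  so the inner integral is the variance at a fixed point.\<close>

lemma sample_noise_nn_integral:
  "(\<integral>\<^sup>+\<omega>. ennreal ((norm (sample_noise i \<omega>))\<^sup>2) \<partial>\<Omega>) \<le> ennreal \<sigma>2"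
proof -
  note [measurable] = sample_noise_meas
  have "(\<integral>\<^sup>+\<omega>. ennreal ((norm (sample_noise i \<omega>))\<^sup>2) \<partial>\<Omega>)
      = (\<integral>\<^sup>+\<omega>. \<integral>\<^sup>+v. ennreal ((norm (sample_noise i (\<omega> (i := v))))\<^sup>2) \<partial>D \<partial>\<Omega>)"
    by (rule nn_integral_resample[OF D]) measurable
  also have "\<dots> \<le> (\<integral>\<^sup>+\<omega>. ennreal \<sigma>2 \<partial>\<Omega>)"
    unfolding sample_noise_update by (intro nn_integral_mono variance)
  also have "\<dots> = ennreal \<sigma>2" by (simp add: \<Omega>.emeasure_space_1)
  finally show ?thesis .
qed

lemma square_integrable_sample_noise: "square_integrable \<Omega> (sample_noise i)"
  unfolding square_integrable_def
proof
  note [measurable] = sample_noise_meas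
  show "sample_noise i \<in> borel_measurable \<Omega>" by measurable
  show "integrable \<Omega> (\<lambda>\<omega>. (norm (sample_noise i \<omega>))\<^sup>2)"
    using sample_noise_nn_integral[of i]
    by (intro integrableI_nonneg) (auto intro: le_less_trans)
qed

lemma sample_noise_variance: "(\<integral>\<omega>. (norm (sample_noise i \<omega>))\<^sup>2 \<partial>\<Omega>) \<le> \<sigma>2"
  using sample_noise_nn_integral[of i] square_integrableD(2)[OF square_integrable_sample_noise, of i]
  by (simp add: nn_integral_eq_integral \<sigma>2_nonneg)

text \<open>When only coordinate \<open>i\<close> is integrated, \<open>Y\<close> and the iterate
  are constants, and unbiasedness makes the inner integral of the noise zero.\<close>

lemma sample_noise_orthogonal:
  assumes Y: "square_integrable \<Omega> Y" and past: "\<And>\<omega> v. Y (\<omega> (i := v)) = Y \<omega>"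
  shows "(\<integral>\<omega>. Y \<omega> \<bullet> sample_noise i \<omega> \<partial>\<Omega>) = 0"
proof -
  have "(\<integral>\<omega>. Y \<omega> \<bullet> sample_noise i \<omega> \<partial>\<Omega>)
      = (\<integral>\<omega>. \<integral>v. Y (\<omega> (i := v)) \<bullet> sample_noise i (\<omega> (i := v)) \<partial>D \<partial>\<Omega>)"
    by (rule integral_resample[OF D integrable_inner_square_integrable[OF Y square_integrable_sample_noise]])
  also have "\<dots> = (\<integral>\<omega>. Y \<omega> \<bullet> (\<integral>v. gradF (X (fst i) \<omega>) v - gradf (X (fst i) \<omega>) \<partial>D) \<partial>\<Omega>)"
    unfolding past sample_noise_update
    by (intro Bochner_Integration.integral_cong refl integral_inner_right) (simp add: unbiased)
  also have "\<dots> = 0" by (simp add: unbiased D.prob_space)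
  finally show ?thesis .
qed

lemma noise_eq:
  "noise t \<omega> = (if t mod \<tau> = 0 then (1 / real B) *\<^sub>R (\<Sum>b<B. sample_noise (t, b) \<omega>)
     else sample_noise (t, 0) \<omega>)"
  using B by (auto simp: noise_def grad_def sample_noise_def sum_subtractf scaleR_diff_right sum_constant_scaleR simp del: sum_constant)

lemma square_integrable_noise: "square_integrable \<Omega> (noise t)"
  unfolding noise_eq[abs_def]
  by (cases "t mod \<tau> = 0")
     (simp_all add: square_integrable_scaleR square_integrable_sum square_integrable_sample_noise \<Omega>.finite_measure_axioms)

lemma square_integrable_gradf:
  "square_integrable \<Omega> (X t) \<Longrightarrow> square_integrable \<Omega> (\<lambda>\<omega>. gradf (X t \<omega>))"
  by (rule lipschitz_square_integrable[OF \<Omega>.finite_measure_axioms _ lip])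

text \<open>Finite second moments propagate because gradients are Lipschitz and projections do not
  increase norms. They justify splitting the expectation of the cross terms.\<close>

lemma square_integrable_state: "square_integrable \<Omega> (X t) \<and> square_integrable \<Omega> (mom t)"
proof (induction t)
  case 0
  have "X 0 = (\<lambda>\<omega>. x0)" "mom 0 = (\<lambda>\<omega>. 0)" by (auto simp: fun_eq_iff state_0 mom_0)
  then show ?case by (simp add: square_integrable_const \<Omega>.finite_measure_axioms)
next
  case (Suc t)
  have "grad t = (\<lambda>\<omega>. noise t \<omega> + gradf (X t \<omega>))" by (simp add: fun_eq_iff noise_def)
  then have "square_integrable \<Omega> (grad t)"
    using square_integrable_add[OF square_integrable_noise square_integrable_gradf] Suc.IH by simp
  then have "square_integrable \<Omega> (\<lambda>\<omega>. (1 - \<beta>) *\<^sub>R mom t \<omega> + \<beta> *\<^sub>R grad t \<omega>)"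
    using Suc.IH by (intro square_integrable_add square_integrable_scaleR) auto
  then have mom: "square_integrable \<Omega> (mom (Suc t))"
    by (rule square_integrable_dominated[OF _ mom_meas, of _ _ 1])
       (simp add: mom_Suc orth_proj_norm_le(1)[OF orth_proj_proj])
  have "X (Suc t) = (\<lambda>\<omega>. X t \<omega> - \<eta> *\<^sub>R mom (Suc t) \<omega>)" by (simp add: fun_eq_iff X_Suc)
  then show ?case
    using mom Suc.IH square_integrable_diff[OF _ square_integrable_scaleR[OF mom]] by simp
qed

lemma square_integrable_bias: "square_integrable \<Omega> (bias t)"
proof -
  have g: "square_integrable \<Omega> (\<lambda>\<omega>. gradf (X t \<omega>))"
    using square_integrable_gradf square_integrable_state by blast
  then have "square_integrable \<Omega> (\<lambda>\<omega>. proj t \<omega> (gradf (X t \<omega>)))"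
    by (rule square_integrable_dominated[of _ _ _ 1])
       (use proj_meas square_integrableD(1)[OF g] orth_proj_norm_le(1)[OF orth_proj_proj] in auto)
  with g show ?thesis
    unfolding bias_def[abs_def] using square_integrable_state[of t]
    by (cases "t mod \<tau> = 0") (auto intro: square_integrable_diff)
qed

lemma bias_noise_orthogonal: "(\<integral>\<omega>. bias t \<omega> \<bullet> noise t \<omega> \<partial>\<Omega>) = 0"
proof -
  have *: "(\<integral>\<omega>. bias t \<omega> \<bullet> sample_noise (t, b) \<omega> \<partial>\<Omega>) = 0" for b
    by (rule sample_noise_orthogonal[OF square_integrable_bias]) (simp add: bias_resample)
  show ?thesis
    unfolding noise_eq
    by (cases "t mod \<tau> = 0")
       (simp_all add: * inner_sum_right integrable_inner_square_integrable[OF square_integrable_bias square_integrable_sample_noise])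
qed

text \<open>Redrawing sample \<open>(t, c)\<close> affects neither the iterate nor the noise of
  another sample \<open>(t, b)\<close>, so the off-diagonal products integrate to zero and only
  \<open>B\<close> of the terms remain.\<close>

lemma noise_variance_refresh:
  assumes "t mod \<tau> = 0"
  shows "(\<integral>\<omega>. (norm (noise t \<omega>))\<^sup>2 \<partial>\<Omega>) \<le> \<sigma>2 / real B"
proof -
  let ?s = "\<lambda>b. sample_noise (t, b)"
  have int: "integrable \<Omega> (\<lambda>\<omega>. ?s b \<omega> \<bullet> ?s c \<omega>)" for b c
    by (intro integrable_inner_square_integrable square_integrable_sample_noise)
  have cross: "(\<integral>\<omega>. ?s b \<omega> \<bullet> ?s c \<omega> \<partial>\<Omega>) = (if b = c then (\<integral>\<omega>. (norm (?s b \<omega>))\<^sup>2 \<partial>\<Omega>) else 0)" for b c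
    using sample_noise_orthogonal[OF square_integrable_sample_noise, of "(t, b)" "(t, c)"]
    by (auto simp: sample_noise_resample power2_norm_eq_inner)
  have "(norm (noise t \<omega>))\<^sup>2 = (1 / (real B)\<^sup>2) * (\<Sum>b<B. \<Sum>c<B. ?s b \<omega> \<bullet> ?s c \<omega>)" for \<omega>
  proof -
    have "(norm (\<Sum>b<B. ?s b \<omega>))\<^sup>2 = (\<Sum>b<B. \<Sum>c<B. ?s b \<omega> \<bullet> ?s c \<omega>)"
      by (simp only: power2_norm_eq_inner inner_sum_left inner_sum_right) (rule sum.swap)
    then show ?thesis using assms by (simp add: noise_eq power_mult_distrib power_divide)
  qed
  then have "(\<integral>\<omega>. (norm (noise t \<omega>))\<^sup>2 \<partial>\<Omega>) = (1 / (real B)\<^sup>2) * (\<Sum>b<B. \<Sum>c<B. \<integral>\<omega>. ?s b \<omega> \<bullet> ?s c \<omega> \<partial>\<Omega>)"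
    by (simp add: int)
  also have "\<dots> = (1 / (real B)\<^sup>2) * (\<Sum>b<B. \<integral>\<omega>. (norm (?s b \<omega>))\<^sup>2 \<partial>\<Omega>)"
    by (simp add: cross)
  also have "\<dots> \<le> (1 / (real B)\<^sup>2) * (\<Sum>b<B. \<sigma>2)"
    by (intro mult_left_mono sum_mono sample_noise_variance) auto
  also have "\<dots> = \<sigma>2 / real B" using B by (simp add: power2_eq_square)
  finally show ?thesis .
qed

lemma noise_variance: "(\<integral>\<omega>. (norm (noise t \<omega>))\<^sup>2 \<partial>\<Omega>) \<le> \<sigma>2"
proof (cases "t mod \<tau> = 0")
  case True
  have "\<sigma>2 / real B \<le> \<sigma>2" using B \<sigma>2_nonneg by (simp add: divide_le_eq mult_le_cancel_left1)
  with noise_variance_refresh[OF True] show ?thesis by simp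
qed (simp add: noise_eq sample_noise_variance)

text \<open>The batch size enters only through the projection error. In the momentum every step,
  refresh or not, is charged the single-sample variance, and \<beta>^2 divided by \<beta> leaves the
  factor \<beta>.\<close>

theorem expected_gradient_bound:
  assumes K: "1 \<le> K"
  shows "7 / 64 * \<eta> * ratio * (\<Sum>t<K * \<tau>. \<integral>\<omega>. (norm (gradf (X t \<omega>)))\<^sup>2 \<partial>\<Omega>)
    \<le> f x0 - (INF x. f x) + \<eta> / 2 * (16 * real \<tau> / ratio * (real K * (\<sigma>2 / real B)) + \<beta> * (real (K * \<tau>) * \<sigma>2))"
proof -
  have g: "integrable \<Omega> (\<lambda>\<omega>. (norm (gradf (X t \<omega>)))\<^sup>2)" for t
    using square_integrableD(2)[OF square_integrable_gradf] square_integrable_state by blast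
  note N = square_integrableD(2)[OF square_integrable_noise]
  note bN = integrable_inner_square_integrable[OF square_integrable_bias square_integrable_noise]
  let ?Z = "\<lambda>\<omega>. \<Sum>t<K * \<tau>. 2 * \<beta> * (1 - \<beta>) * (bias t \<omega> \<bullet> noise t \<omega>) + \<beta>\<^sup>2 * (norm (noise t \<omega>))\<^sup>2"
  let ?S = "\<lambda>\<omega>. \<Sum>k<K. (norm (noise (k * \<tau>) \<omega>))\<^sup>2"
  have "(\<integral>\<omega>. ?Z \<omega> \<partial>\<Omega>) = (\<Sum>t<K * \<tau>. \<beta>\<^sup>2 * (\<integral>\<omega>. (norm (noise t \<omega>))\<^sup>2 \<partial>\<Omega>))"
    by (simp add: N bN bias_noise_orthogonal)
  also have "\<dots> \<le> (\<Sum>t<K * \<tau>. \<beta>\<^sup>2 * \<sigma>2)"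
    by (intro sum_mono mult_left_mono noise_variance) auto
  finally have Z: "1 / \<beta> * (\<integral>\<omega>. ?Z \<omega> \<partial>\<Omega>) \<le> \<beta> * (real (K * \<tau>) * \<sigma>2)"
    using \<beta> by (simp add: field_simps power2_eq_square)
  have S: "(\<integral>\<omega>. ?S \<omega> \<partial>\<Omega>) \<le> real K * (\<sigma>2 / real B)"
    using sum_mono[of "{..<K}" "\<lambda>k. \<integral>\<omega>. (norm (noise (k * \<tau>) \<omega>))\<^sup>2 \<partial>\<Omega>" "\<lambda>k. \<sigma>2 / real B"]
    by (simp add: N noise_variance_refresh)
  have "7 / 64 * \<eta> * ratio * (\<Sum>t<K * \<tau>. \<integral>\<omega>. (norm (gradf (X t \<omega>)))\<^sup>2 \<partial>\<Omega>)
      = (\<integral>\<omega>. 7 / 64 * \<eta> * ratio * (\<Sum>t<K * \<tau>. (norm (gradf (X t \<omega>)))\<^sup>2) \<partial>\<Omega>)"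
    by (simp add: g)
  also have "\<dots> \<le> (\<integral>\<omega>. f x0 - (INF x. f x) + \<eta> / 2 * (16 * real \<tau> / ratio * ?S \<omega> + 1 / \<beta> * ?Z \<omega>) \<partial>\<Omega>)"
    by (rule integral_mono[OF _ _ path_inequality[OF K]]) (auto simp: g N bN)
  also have "\<dots> = f x0 - (INF x. f x) + \<eta> / 2 * (16 * real \<tau> / ratio * (\<integral>\<omega>. ?S \<omega> \<partial>\<Omega>) + 1 / \<beta> * (\<integral>\<omega>. ?Z \<omega> \<partial>\<Omega>))"
    by (simp add: N bN \<Omega>.prob_space)
  also have "\<dots> \<le> f x0 - (INF x. f x) + \<eta> / 2 * (16 * real \<tau> / ratio * (real K * (\<sigma>2 / real B)) + \<beta> * (real (K * \<tau>) * \<sigma>2))"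
    using \<eta> ratio_bounds by (intro add_left_mono mult_left_mono add_mono S Z) auto
  finally show ?thesis .
qed

end

section \<open>From the expected path bound to the stated constants\<close>

theorem theoremB3:
  fixes D :: "'b measure"
    and NL :: nat and m n r :: "nat \<Rightarrow> nat"
    and crd :: "'d::finite \<Rightarrow> nat \<times> nat \<times> nat"
    and F :: "real^'d \<Rightarrow> 'b \<Rightarrow> real" and gradF :: "real^'d \<Rightarrow> 'b \<Rightarrow> real^'d"
    and f :: "real^'d \<Rightarrow> real" and gradf :: "real^'d \<Rightarrow> real^'d"
    and L :: real and \<sigma> :: "nat \<Rightarrow> real"
    and sel :: "nat \<Rightarrow> nat \<Rightarrow> rmat \<Rightarrow> rmat \<times> rmat"
    and x0 :: "real^'d" and \<beta> \<eta> :: real and \<tau> B K :: nat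
  assumes D: "prob_space D"
    and crd: "bij_betw crd UNIV {(l, i, j). l < NL \<and> i < m l \<and> j < n l}"
    and rank: "\<forall>l<NL. 0 < r l \<and> r l < min (m l) (n l)"
    (* F(.;xi) differentiable with gradient gradF, f = E F differentiable with gradient gradf *)
    and F_deriv: "\<forall>x \<xi>. ((\<lambda>y. F y \<xi>) has_derivative (\<lambda>h. gradF x \<xi> \<bullet> h)) (at x)"
    and f_def: "\<forall>x. integrable D (F x) \<and> f x = (\<integral>\<xi>. F x \<xi> \<partial>D)"
    and f_deriv: "\<forall>x. (f has_derivative (\<lambda>h. gradf x \<bullet> h)) (at x)"
    (* Assumption 1 *)
    and A1: "bdd_below (range f)"
    (* Assumption 2 *)
    and L_pos: "0 < L"
    and A2: "\<forall>x y. norm (gradf x - gradf y) \<le> L * norm (x - y)"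
    (* Assumption 3 *)
    and A3_unbiased: "\<forall>x. integrable D (gradF x) \<and> (\<integral>\<xi>. gradF x \<xi> \<partial>D) = gradf x"
    and A3_var: "\<forall>x. \<forall>l<NL.
        (\<integral>\<^sup>+\<xi>. ennreal (frob2 (m l) (n l) (layer crd l (gradF x \<xi> - gradf x))) \<partial>D)
          \<le> ennreal ((\<sigma> l)\<^sup>2)"
    (* measurability (implicit in the paper) *)
    and gradF_meas: "(\<lambda>(x, \<xi>). gradF x \<xi>) \<in> borel_measurable (borel \<Otimes>\<^sub>M D)"
    and sel_meas: "\<forall>t l i j.
        (\<lambda>g::real^'d. fst (sel t l (layer crd l g)) i j) \<in> borel_measurable borel \<and>
        (\<lambda>g::real^'d. snd (sel t l (layer crd l g)) i j) \<in> borel_measurable borel"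
    (* the subspace is taken from an SVD *)
    and sel_svd: "\<forall>t l G. l < NL \<longrightarrow>
        svd_trunc (m l) (n l) (r l) G (fst (sel t l G)) (snd (sel t l G))"
    and B: "1 \<le> B"
    and \<beta>: "0 < \<beta>" "\<beta> \<le> 1"
    and \<tau>: "real \<tau> \<ge> 64 / (3 * \<beta> * Min ((\<lambda>l. real (r l) / real (min (m l) (n l))) ` {..<NL}))"
    and \<eta>_pos: "0 < \<eta>"
    and \<eta>_le: "\<eta> \<le> Min {1 / (4 * L),
        sqrt (3 * Min ((\<lambda>l. real (r l) / real (min (m l) (n l))) ` {..<NL}) * \<beta>\<^sup>2 / (80 * L\<^sup>2)),
        sqrt (Min ((\<lambda>l. real (r l) / real (min (m l) (n l))) ` {..<NL}) / (40 * (real \<tau>)\<^sup>2 * L\<^sup>2)),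
        sqrt (3 * \<beta> / (32 * real \<tau> * L\<^sup>2))}"
    and K: "1 \<le> K"
  shows
    "(let \<delta> = Min ((\<lambda>l. real (r l) / real (min (m l) (n l))) ` {..<NL});
          \<Delta> = f x0 - (INF x. f x);
          \<sigma>2 = (\<Sum>l<NL. (\<sigma> l)\<^sup>2);
          \<Omega> = (\<Pi>\<^sub>M ij\<in>(UNIV :: (nat \<times> nat) set). D)
      in ennreal (1 / (real K * real \<tau>)) *
         (\<Sum>t<K * \<tau>. \<integral>\<^sup>+\<omega>. ennreal ((norm (gradf (iterate crd m n r gradF sel x0 \<beta> \<eta> \<tau> B \<omega> t)))\<^sup>2) \<partial>\<Omega>)
       \<le> ennreal (16 * \<Delta> / (\<delta> * \<eta> * real K * real \<tau>)
           + (160 / (3 * \<beta> * \<delta> * real \<tau> * real B) + 352 / (3 * \<delta>\<^sup>2 * real B)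
              + 32 * \<beta> / (3 * \<delta>)) * \<sigma>2))"
proof -
  interpret D: prob_space D by (rule D)
  interpret lay: layered NL m n r crd
    using crd rank by unfold_locales auto
  define \<sigma>2 where "\<sigma>2 = (\<Sum>l<NL. (\<sigma> l)\<^sup>2)"
  have ratio: "0 < lay.ratio" "lay.ratio \<le> 1"
    by (rule lay.ratio_bounds)+
  have \<tau>': "64 / (3 * \<beta> * lay.ratio) \<le> real \<tau>"
    using \<tau> by (simp add: lay.ratio_def)
  have \<tau>_pos: "0 < \<tau>"
    using less_le_trans[OF _ \<tau>', of 0] ratio \<beta> by simp
  have \<tau>_ge: "64 \<le> 3 * \<beta> * lay.ratio * real \<tau>"
    using \<tau>' ratio \<beta> by (simp add: divide_le_eq mult.commute mult.left_commute)
  have \<eta>_bounds: "\<eta> \<le> 1 / (4 * L)" "\<eta> \<le> sqrt (3 * lay.ratio * \<beta>\<^sup>2 / (80 * L\<^sup>2))"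
      "\<eta> \<le> sqrt (lay.ratio / (40 * (real \<tau>)\<^sup>2 * L\<^sup>2))" "\<eta> \<le> sqrt (3 * \<beta> / (32 * real \<tau> * L\<^sup>2))"
    using \<eta>_le by (simp_all add: lay.ratio_def)
  have sq: "\<eta>\<^sup>2 \<le> c" if "\<eta> \<le> sqrt c" "0 \<le> c" for c
    using power_mono[OF that(1), of 2] \<eta>_pos that(2) by simp
  have variance: "(\<integral>\<^sup>+\<xi>. ennreal ((norm (gradF x \<xi> - gradf x))\<^sup>2) \<partial>D) \<le> ennreal \<sigma>2" for x
  proof -
    have "gradF x \<in> borel_measurable D" using A3_unbiased by (blast intro: borel_measurable_integrable)
    then have [measurable]: "(\<lambda>\<xi>. frob2 (m l) (n l) (layer crd l (gradF x \<xi> - gradf x))) \<in> borel_measurable D" for l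
      unfolding frob2_def
      by (intro borel_measurable_sum borel_measurable_power lay.measurable_layer borel_measurable_diff) auto
    have nonneg: "0 \<le> frob2 (m l) (n l) A" for l A
      by (simp add: frob2_def sum_nonneg)
    \<comment> \<open>The squared norm is the sum of the layers' squared Frobenius norms, so the
      layerwise variance bounds add up; measurability lets the integral pass through the
      sum.\<close>
    have "ennreal ((norm v)\<^sup>2) = (\<Sum>l<NL. ennreal (frob2 (m l) (n l) (layer crd l v)))" for v
      by (simp add: lay.norm_sq_layers sum_ennreal nonneg)
    then have "(\<integral>\<^sup>+\<xi>. ennreal ((norm (gradF x \<xi> - gradf x))\<^sup>2) \<partial>D)
        = (\<Sum>l<NL. \<integral>\<^sup>+\<xi>. ennreal (frob2 (m l) (n l) (layer crd l (gradF x \<xi> - gradf x))) \<partial>D)"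
      by (simp only:) (rule nn_integral_sum, measurable)
    also have "\<dots> \<le> (\<Sum>l<NL. ennreal ((\<sigma> l)\<^sup>2))"
      using A3_var by (intro sum_mono) auto
    finally show ?thesis by (simp add: \<sigma>2_def sum_ennreal)
  qed
  interpret gp: galore_process NL m n r crd D gradF f gradf L \<sigma>2 sel x0 \<beta> \<eta> \<tau> B
  proof unfold_locales
    show "4 * L * \<eta> \<le> 1" using \<eta>_bounds(1) L_pos by (simp add: field_simps)
    show "80 * L\<^sup>2 * \<eta>\<^sup>2 \<le> 3 * lay.ratio * \<beta>\<^sup>2"
      using sq[OF \<eta>_bounds(2)] ratio L_pos by (simp add: field_simps)
    show "40 * (real \<tau>)\<^sup>2 * L\<^sup>2 * \<eta>\<^sup>2 \<le> lay.ratio"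
      using sq[OF \<eta>_bounds(3)] ratio L_pos \<tau>_pos by (simp add: field_simps)
    show "32 * real \<tau> * L\<^sup>2 * \<eta>\<^sup>2 \<le> 3 * \<beta>"
      using sq[OF \<eta>_bounds(4)] \<beta> L_pos \<tau>_pos by (simp add: field_simps)
    show "0 \<le> \<sigma>2" by (simp add: \<sigma>2_def sum_nonneg)
  qed (use f_deriv A1 A2 A3_unbiased variance gradF_meas sel_meas sel_svd B \<beta> \<eta>_pos \<tau>_pos \<tau>_ge in auto)
  let ?g = "\<lambda>t \<omega>. (norm (gradf (gp.X t \<omega>)))\<^sup>2"
  define \<Delta> where "\<Delta> = f x0 - (INF x. f x)"
  define S where "S = (\<Sum>t<K * \<tau>. \<integral>\<omega>. ?g t \<omega> \<partial>gp.\<Omega>)"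
  define T where "T = real K * real \<tau>"
  have T: "0 < T" using K \<tau>_pos by (simp add: T_def)
  \<comment> \<open>Nonnegativity of \<Delta> and of the total variance is what permits enlarging
    their coefficients at the end.\<close>
  have \<Delta>: "0 \<le> \<Delta>" using cINF_lower[OF A1, of x0] by (simp add: \<Delta>_def)
  have \<sigma>2: "0 \<le> \<sigma>2" by (simp add: \<sigma>2_def sum_nonneg)
  have g: "integrable gp.\<Omega> (?g t)" for t
    using square_integrableD(2)[OF gp.square_integrable_gradf] gp.square_integrable_state by blast
  have "7 / 64 * \<eta> * lay.ratio * S \<le> \<Delta> + \<eta> / 2 * (16 * real \<tau> / lay.ratio * (real K * (\<sigma>2 / real B)) + \<beta> * (real (K * \<tau>) * \<sigma>2))"
    unfolding S_def \<Delta>_def by (rule gp.expected_gradient_bound[OF K])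
  then have "S \<le> (\<Delta> + \<eta> / 2 * (16 * real \<tau> / lay.ratio * (real K * (\<sigma>2 / real B)) + \<beta> * (real (K * \<tau>) * \<sigma>2))) / (7 / 64 * \<eta> * lay.ratio)"
    using \<eta>_pos ratio by (simp add: pos_le_divide_eq mult.commute)
  \<comment> \<open>Dividing by 7/64 turns the coefficients 1, 16/2 and 1/2 into 64/7, 512/7 and
    32/7.\<close>
  also have "\<dots> = T * (64 / 7 * \<Delta> / (lay.ratio * \<eta> * T) + (512 / 7 / (lay.ratio\<^sup>2 * real B) + 32 / 7 * \<beta> / lay.ratio) * \<sigma>2)"
    using \<eta>_pos ratio K \<tau>_pos B by (simp add: T_def field_simps power2_eq_square)
  \<comment> \<open>Pure weakening: 64/7 is at most 16, 512/7 at most 352/3, 32/7 at most 32/3, and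
    the remaining summand is nonnegative.\<close>
  also have "\<dots> \<le> T * (16 * \<Delta> / (lay.ratio * \<eta> * T)
      + (160 / (3 * \<beta> * lay.ratio * real \<tau> * real B) + 352 / 3 / (lay.ratio\<^sup>2 * real B) + 32 / 3 * \<beta> / lay.ratio) * \<sigma>2)"
  proof -
    have "512 / 7 / (lay.ratio\<^sup>2 * real B) \<le> 352 / 3 / (lay.ratio\<^sup>2 * real B)"
      by (intro divide_right_mono) auto
    moreover have "32 / 7 * \<beta> / lay.ratio \<le> 32 / 3 * \<beta> / lay.ratio"
      using \<beta> ratio by (intro divide_right_mono) auto
    moreover have "0 \<le> 160 / (3 * \<beta> * lay.ratio * real \<tau> * real B)"
      using \<beta> ratio by simp
    ultimately have coeff: "512 / 7 / (lay.ratio\<^sup>2 * real B) + 32 / 7 * \<beta> / lay.ratio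
      \<le> 160 / (3 * \<beta> * lay.ratio * real \<tau> * real B) + 352 / 3 / (lay.ratio\<^sup>2 * real B) + 32 / 3 * \<beta> / lay.ratio"
      by linarith
    have "64 / 7 * \<Delta> / (lay.ratio * \<eta> * T) \<le> 16 * \<Delta> / (lay.ratio * \<eta> * T)"
      using \<Delta> ratio \<eta>_pos T by (intro divide_right_mono) auto
    from add_mono[OF this mult_right_mono[OF coeff \<sigma>2]] T show ?thesis
      by (intro mult_left_mono) auto
  qed
  finally have "1 / T * S \<le> 16 * \<Delta> / (lay.ratio * \<eta> * T)
      + (160 / (3 * \<beta> * lay.ratio * real \<tau> * real B) + 352 / 3 / (lay.ratio\<^sup>2 * real B) + 32 / 3 * \<beta> / lay.ratio) * \<sigma>2"
    using T by (simp add: pos_divide_le_eq mult.commute)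
  also have "\<dots> = 16 * \<Delta> / (lay.ratio * \<eta> * real K * real \<tau>)
      + (160 / (3 * \<beta> * lay.ratio * real \<tau> * real B) + 352 / (3 * lay.ratio\<^sup>2 * real B) + 32 * \<beta> / (3 * lay.ratio)) * \<sigma>2"
    by (simp add: T_def mult.assoc)
  finally have bound: "1 / T * S \<le> \<dots>" .
  \<comment> \<open>Integrability of the squared gradients identifies the nonnegative integrals of
    the claim with the real ones bounded above.\<close>
  have "(\<Sum>t<K * \<tau>. \<integral>\<^sup>+\<omega>. ennreal (?g t \<omega>) \<partial>gp.\<Omega>) = ennreal S"
    unfolding S_def by (simp add: nn_integral_eq_integral g sum_ennreal)
  then have "ennreal (1 / T) * (\<Sum>t<K * \<tau>. \<integral>\<^sup>+\<omega>. ennreal (?g t \<omega>) \<partial>gp.\<Omega>) = ennreal (1 / T * S)"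
    using T ennreal_mult'[of "1 / T" S] by simp
  with ennreal_leI[OF bound] show ?thesis
    by (simp add: Let_def lay.ratio_def[symmetric] \<Delta>_def \<sigma>2_def T_def iterate_def gp.X_def)
qed

end
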